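(* Alice and Bob have matrices $A^1,A^2\in\mathbb{R}^{n\times d}$ respectively. Let $A\in\mathbb{R}^{n\times d}$ be given by $A_{i,j}=\max(A^1_{i,j},A^2_{i,j})$ (or by $A_{i,j}=\psi(A^1_{i,j}+A^2_{i,j})$, where $\psi$ is the $\psi$-function of Huber). For $k>1$, the communication of computing, with probability $2/3$, a rank-$k$ projection matrix $P$ such that $$\|A-AP\|_F^2\le(1+\varepsilon)\|A-[A]_k\|_F^2$$ needs $\tilde\Omega(nd)$ bits.
   Context: The Huber $\psi$-function with threshold $\kappa$ is $\psi(x)=x$ if $|x|\le\kappa$ and $\psi(x)=\kappa\cdot\mathrm{sgn}(x)$ if $|x|>\kappa$. Here $k$ is an integer, $\varepsilon>0$, and $n\gg d$. $P$ is a $d\times d$ projection matrix; $\|\cdot\|_F$ is the Frobenius norm, $\|A\|_F^2=\sum_{i,j}A_{i,j}^2$; $[A]_k$ is the best rank-$k$ approximation to $A$, given by the singular value decomposition. Communication is the number of bits exchanged between Alice and Bob by a protocol that computes $P$. $\tilde\Omega(\cdot)$ denotes $\Omega(\cdot)$ with polylogarithmic factors suppressed. *)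

theory Defs
  imports
    "HOL-Probability.Probability_Measure"
    "Jordan_Normal_Form.DL_Rank"
begin

definition huber :: "real \<Rightarrow> real \<Rightarrow> real" where
  "huber \<kappa> x = (if \<bar>x\<bar> \<le> \<kappa> then x else \<kappa> * sgn x)"

definition entrywise :: "(real \<Rightarrow> real \<Rightarrow> real) \<Rightarrow> real mat \<Rightarrow> real mat \<Rightarrow> real mat" where
  "entrywise g A B = Matrix.mat (dim_row A) (dim_col A) (\<lambda>(i, j). g (A $$ (i, j)) (B $$ (i, j)))"

definition frob_norm :: "real mat \<Rightarrow> real" where
  "frob_norm A = sqrt (\<Sum>i<dim_row A. \<Sum>j<dim_col A. (A $$ (i, j))\<^sup>2)"

definition is_svd :: "real mat \<Rightarrow> real mat \<Rightarrow> real mat \<Rightarrow> real mat \<Rightarrow> bool" where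
  "is_svd A U S V \<longleftrightarrow>
     (let n = dim_row A; d = dim_col A in
      U \<in> carrier_mat n n \<and> S \<in> carrier_mat n d \<and> V \<in> carrier_mat d d \<and>
      transpose_mat U * U = 1\<^sub>m n \<and> transpose_mat V * V = 1\<^sub>m d \<and>
      diagonal_mat S \<and>
      (\<forall>i < min n d. 0 \<le> S $$ (i, i)) \<and>
      (\<forall>i j. i \<le> j \<and> j < min n d \<longrightarrow> S $$ (j, j) \<le> S $$ (i, i)) \<and>
      A = U * S * transpose_mat V)"

definition truncate_diag :: "nat \<Rightarrow> real mat \<Rightarrow> real mat" where
  "truncate_diag k S =
     Matrix.mat (dim_row S) (dim_col S) (\<lambda>(i, j). if i = j \<and> i < k then S $$ (i, j) else 0)"

(* A relation rather than a function: when the k-th and (k+1)-st singular values coincide, [A]_k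
   depends on the chosen decomposition. The error of A - [A]_k in Frobenius norm does not. *)
definition svd_truncation :: "nat \<Rightarrow> real mat \<Rightarrow> real mat \<Rightarrow> bool" where
  "svd_truncation k A B \<longleftrightarrow>
     (\<exists>U S V. is_svd A U S V \<and> B = U * truncate_diag k S * transpose_mat V)"

(* Symmetry of P is not demanded, so that a lower bound for computing such a P
   applies in particular to orthogonal projections. *)
definition rank_projection :: "nat \<Rightarrow> nat \<Rightarrow> real mat \<Rightarrow> bool" where
  "rank_projection d k P \<longleftrightarrow> P \<in> carrier_mat d d \<and> P * P = P \<and> vec_space.rank d P = k"

definition good_projection :: "nat \<Rightarrow> real \<Rightarrow> real mat \<Rightarrow> real mat \<Rightarrow> bool" where
  "good_projection k \<epsilon> A P \<longleftrightarrow>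
     rank_projection (dim_col A) k P \<and>
     (\<exists>B. svd_truncation k A B \<and>
        (frob_norm (A - A * P))\<^sup>2 \<le> (1 + \<epsilon>) * (frob_norm (A - B))\<^sup>2)"

(* Deterministic two-party protocol trees. At an inner node one party sends one bit, a function of
   its own input; the bits sent so far are the position in the tree. At a leaf one party announces
   the result, which may depend on its own input as well as on the transcript. Leaves whose
   result is determined by the transcript alone are the case of a constant function. *)
datatype ('a, 'b, 'o) protocol =
    Alice_Out "'a \<Rightarrow> 'o"
  | Bob_Out "'b \<Rightarrow> 'o"
  | Alice_Bit "'a \<Rightarrow> bool" "('a, 'b, 'o) protocol" "('a, 'b, 'o) protocol"
  | Bob_Bit "'b \<Rightarrow> bool" "('a, 'b, 'o) protocol" "('a, 'b, 'o) protocol"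

primrec run :: "('a, 'b, 'o) protocol \<Rightarrow> 'a \<Rightarrow> 'b \<Rightarrow> 'o" where
  "run (Alice_Out f) x y = f x"
| "run (Bob_Out f) x y = f y"
| "run (Alice_Bit q l r) x y = (if q x then run l x y else run r x y)"
| "run (Bob_Bit q l r) x y = (if q y then run l x y else run r x y)"

primrec bits :: "('a, 'b, 'o) protocol \<Rightarrow> 'a \<Rightarrow> 'b \<Rightarrow> nat" where
  "bits (Alice_Out f) x y = 0"
| "bits (Bob_Out f) x y = 0"
| "bits (Alice_Bit q l r) x y = Suc (if q x then bits l x y else bits r x y)"
| "bits (Bob_Bit q l r) x y = Suc (if q y then bits l x y else bits r x y)"

definition inputs :: "real set \<Rightarrow> nat \<Rightarrow> nat \<Rightarrow> real mat set" where
  "inputs X n d = {A \<in> carrier_mat n d. elements_mat A \<subseteq> X}"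

(* A randomized protocol is a probability measure on deterministic protocols (public coins, which
   subsume private ones). X is the set of admissible matrix entries: X = UNIV gives arbitrary real
   matrices, smaller X matrices of bounded precision. A non-measurable success event has
   measure 0, so the last conjunct includes its measurability. *)
definition computes_projection ::
  "(real \<Rightarrow> real \<Rightarrow> real) \<Rightarrow> real set \<Rightarrow> nat \<Rightarrow> nat \<Rightarrow> nat \<Rightarrow> real \<Rightarrow> nat \<Rightarrow>
     (real mat, real mat, real mat) protocol measure \<Rightarrow> bool" where
  "computes_projection g X n d k \<epsilon> b R \<longleftrightarrow>
     prob_space R \<and>
     (\<forall>A1 \<in> inputs X n d. \<forall>A2 \<in> inputs X n d.
        (\<forall>\<pi> \<in> space R. bits \<pi> A1 A2 \<le> b) \<and>
        measure R {\<pi> \<in> space R. good_projection k \<epsilon> (entrywise g A1 A2) (run \<pi> A1 A2)} \<ge> 2 / 3)"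

end

theory Submission
  imports Defs
begin

text \<open>On inputs with entries in \<open>{0, s}\<close> both functions compute \<open>s\<close> times the entrywise OR, so
  complementing the inputs turns the zeros of \<open>A\<close> into the intersection of two sets of cells.
  Take a fixed 0/1 matrix of rank \<open>k - 1\<close>, most of whose rows are all-ones, and promise a unique
  intersecting cell \<open>(r, j)\<close>. Then \<open>A\<close> has rank \<open>k\<close>, the error \<open>A - [A]\<^sub>k\<close> vanishes, and \<open>P\<close> must
  fix the row space of \<open>A\<close>, which contains \<open>e\<^sub>j\<close>. The fixed rows are chosen such that no rank-\<open>k\<close>
  projection serves both an odd and an even column, so the protocol finds the parity of \<open>j\<close>.

  That this takes linear communication is a variant of the lower bound for set disjointness. On
  random disjoint inputs few transcripts correlate with a typical element (a level-1
  inequality), so by the rectangle property making that element common to both inputs hardly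
  lowers the probability of any answer. But on disjoint inputs the answer cannot depend on the
  element, and hence it is wrong about half of the time.\<close>

subsection \<open>Rectangles and unique intersections\<close>

lemma sum_Pow_insert:
  fixes f :: "'c set \<Rightarrow> 'd::comm_monoid_add"
  assumes "finite F" "i \<notin> F"
  shows "(\<Sum>z\<in>Pow (insert i F). f z) = (\<Sum>z\<in>Pow F. f z + f (insert i z))"
proof -
  have "inj_on (insert i) (Pow F)"
    using assms(2) by (auto simp: inj_on_def)
  moreover have "Pow F \<inter> insert i ` Pow F = {}" using assms(2) by auto
  ultimately show ?thesis
    using assms(1) by (simp add: Pow_insert sum.union_disjoint sum.reindex sum.distrib)
qed

text \<open>For fixed \<open>D\<close>, the parts \<open>z \<inter> D\<close> and
  \<open>z - D\<close> of a uniformly random \<open>z\<close> are independent; this makes the weight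
  of a rectangle a product.\<close>

lemma sum_Pow_split:
  fixes f g :: "'c set \<Rightarrow> real"
  assumes "finite J" "D \<subseteq> J"
  shows "(\<Sum>z\<in>Pow J. f (z \<inter> D) * g (z - D)) = (\<Sum>u\<in>Pow D. f u) * (\<Sum>w\<in>Pow (J - D). g w)"
proof -
  have "(\<Sum>z\<in>Pow J. f (z \<inter> D) * g (z - D)) = (\<Sum>(u, w)\<in>Pow D \<times> Pow (J - D). f u * g w)"
    by (rule sum.reindex_bij_witness[where i = "\<lambda>(u, w). u \<union> w" and j = "\<lambda>z. (z \<inter> D, z - D)"])
      (use assms(2) in auto)
  then show ?thesis by (simp add: sum_product sum.cartesian_product)
qed

section \<open>Exponential moments of random signs and the level-1 inequality\<close>

definition sgn_mem :: "'c \<Rightarrow> 'c set \<Rightarrow> real" where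
  "sgn_mem i z = (if i \<in> z then 1 else -1)"

text \<open>The moment generating function of a sum of independent signs is a product over the
  coordinates, so induction on \<open>I\<close> peels off one factor
  \<open>exp (s i) + exp (- s i)\<close>, which is at most
  \<open>2 * exp (\<mu>\<^sup>2)\<close>.\<close>

lemma sum_exp_sgn_mem_le:
  fixes s :: "'c \<Rightarrow> real" and \<mu> :: real
  assumes "finite I" "\<And>i. i \<in> I \<Longrightarrow> \<bar>s i\<bar> \<le> \<mu>" "\<mu> \<le> 1"
  shows "(\<Sum>z\<in>Pow I. exp (\<Sum>i\<in>I. s i * sgn_mem i z)) \<le> 2 ^ card I * exp (\<mu>\<^sup>2 * real (card I))"
  using assms(1,2)
proof (induction I rule: finite_induct)
  case (insert i F)
  have si: "\<bar>s i\<bar> \<le> \<mu>" using insert.prems by simp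
  \<comment> \<open>The linear terms cancel once this is added for \<open>s i\<close> and
    \<open>- s i\<close>. For negative \<open>t\<close> it follows from
    \<open>exp (- t) \<ge> 1 - t\<close> and
    \<open>(1 + t + t\<^sup>2) * (1 - t) = 1 - t ^ 3 \<ge> 1\<close>.\<close>
  have "exp t \<le> 1 + t + \<mu>\<^sup>2" if "\<bar>t\<bar> \<le> \<mu>" for t :: real
  proof -
    have "exp t \<le> 1 + t + t\<^sup>2"
    proof (cases "0 \<le> t")
      case True
      then show ?thesis using exp_bound[of t] that assms(3) by simp
    next
      case False
      then have "1 - t > 0" by simp
      have "1 - t \<le> exp (- t)" using exp_ge_add_one_self[of "- t"] by simp
      then have "exp t * (1 - t) \<le> 1"
        using mult_left_mono[of "1 - t" "exp (- t)" "exp t"] by (simp add: exp_minus)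
      moreover have "1 \<le> (1 + t + t\<^sup>2) * (1 - t)"
      proof -
        have "(1 + t + t\<^sup>2) * (1 - t) = 1 - t ^ 3"
          by (simp add: algebra_simps power2_eq_square power3_eq_cube)
        moreover have "t ^ 3 \<le> 0" using False by (simp add: power_le_zero_eq)
        ultimately show ?thesis by simp
      qed
      ultimately have "exp t * (1 - t) \<le> (1 + t + t\<^sup>2) * (1 - t)" by linarith
      then show ?thesis using \<open>1 - t > 0\<close> by (simp add: mult_le_cancel_right)
    qed
    moreover have "t\<^sup>2 \<le> \<mu>\<^sup>2" using that by (simp add: abs_le_square_iff[symmetric])
    ultimately show ?thesis by simp
  qed
  from this[of "s i"] this[of "- s i"] si
  have "exp (s i) + exp (- s i) \<le> 2 * (1 + \<mu>\<^sup>2)" by simp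
  also have "\<dots> \<le> 2 * exp (\<mu>\<^sup>2)" by (intro mult_left_mono exp_ge_add_one_self) simp
  finally have one: "exp (s i) + exp (- s i) \<le> 2 * exp (\<mu>\<^sup>2)" .
  let ?S = "\<lambda>z. \<Sum>j\<in>F. s j * sgn_mem j z"
  have ne: "sgn_mem j (insert i z) = sgn_mem j z" if "j \<in> F" for j z
    using that insert.hyps by (auto simp: sgn_mem_def)
  have "(\<Sum>z\<in>Pow (insert i F). exp (\<Sum>j\<in>insert i F. s j * sgn_mem j z))
      = (\<Sum>z\<in>Pow F. exp (\<Sum>j\<in>insert i F. s j * sgn_mem j z)
          + exp (\<Sum>j\<in>insert i F. s j * sgn_mem j (insert i z)))"
    using insert.hyps by (rule sum_Pow_insert)
  also have "\<dots> = (\<Sum>z\<in>Pow F. (exp (s i) + exp (- s i)) * exp (?S z))"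
  proof (rule sum.cong[OF refl])
    fix z assume "z \<in> Pow F"
    then have "i \<notin> z" using insert.hyps by auto
    then show "exp (\<Sum>j\<in>insert i F. s j * sgn_mem j z)
          + exp (\<Sum>j\<in>insert i F. s j * sgn_mem j (insert i z))
        = (exp (s i) + exp (- s i)) * exp (?S z)"
      using insert.hyps ne
      by (simp add: exp_add exp_diff exp_minus divide_inverse distrib_right sgn_mem_def[of i] mult_ac cong: sum.cong)
  qed
  also have "\<dots> = (exp (s i) + exp (- s i)) * (\<Sum>z\<in>Pow F. exp (?S z))"
    by (simp add: sum_distrib_left)
  also have "\<dots> \<le> (2 * exp (\<mu>\<^sup>2)) * (2 ^ card F * exp (\<mu>\<^sup>2 * card F))"
    using one insert by (intro mult_mono) (auto intro: sum_nonneg)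
  also have "\<dots> = 2 ^ card (insert i F) * exp (\<mu>\<^sup>2 * card (insert i F))"
    using insert.hyps by (simp add: exp_add[symmetric] algebra_simps)
  finally show ?case .
qed simp

text \<open>This level-1 inequality follows by summing \<open>t - h + 1 \<le> exp (t - h)\<close> over all \<open>z\<close>, where
  \<open>h = ln (card \<Omega>) + \<mu>\<^sup>2 card I\<close> and \<open>t\<close> is \<open>\<mu>\<close> times a signed sum of the \<open>sgn_mem i z\<close>. It needs
  neither entropy nor a division by the sizes of the fibres of \<open>T\<close>.\<close>

lemma sum_level_one_le:
  fixes T :: "'c set \<Rightarrow> 't" and \<mu> :: real
  assumes "finite I" "finite \<Omega>" "\<Omega> \<noteq> {}" "\<And>z. z \<subseteq> I \<Longrightarrow> T z \<in> \<Omega>" "0 < \<mu>" "\<mu> \<le> 1"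
  shows "\<mu> * (\<Sum>\<tau>\<in>\<Omega>. \<Sum>i\<in>I. \<bar>\<Sum>z\<in>Pow I. of_bool (T z = \<tau>) * sgn_mem i z\<bar>)
    \<le> 2 ^ card I * (ln (card \<Omega>) + \<mu>\<^sup>2 * card I)"
proof -
  define K :: real where "K = card \<Omega>"
  have K: "K > 0" using assms(2,3) by (simp add: K_def card_gt_0_iff)
  define h where "h = ln K + \<mu>\<^sup>2 * card I"
  have leaf: "\<mu> * (\<Sum>i\<in>I. \<bar>\<Sum>z\<in>Pow I. of_bool (T z = \<tau>) * sgn_mem i z\<bar>)
      \<le> 2 ^ card I / K + (h - 1) * (\<Sum>z\<in>Pow I. of_bool (T z = \<tau>))" for \<tau>
  proof -
    define s where "s i = \<mu> * sgn (\<Sum>z\<in>Pow I. of_bool (T z = \<tau>) * sgn_mem i z)" for i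
    have s: "\<bar>s i\<bar> \<le> \<mu>" for i using assms(5) by (simp add: s_def abs_mult sgn_real_def)
    have "\<mu> * (\<Sum>i\<in>I. \<bar>\<Sum>z\<in>Pow I. of_bool (T z = \<tau>) * sgn_mem i z\<bar>)
        = (\<Sum>i\<in>I. s i * (\<Sum>z\<in>Pow I. of_bool (T z = \<tau>) * sgn_mem i z))"
      by (simp add: sum_distrib_left s_def abs_sgn mult_ac)
    also have "\<dots> = (\<Sum>z\<in>Pow I. of_bool (T z = \<tau>) * (\<Sum>i\<in>I. s i * sgn_mem i z))"
      by (simp add: sum_distrib_left sum.swap[of _ I] mult_ac)
    \<comment> \<open>On the fibre \<open>T z = \<tau>\<close> this is
      \<open>t \<le> exp (t - h) + h - 1\<close>; off it the left side is 0 and the right side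
      positive.\<close>
    also have "\<dots> \<le> (\<Sum>z\<in>Pow I. exp (- h) * exp (\<Sum>i\<in>I. s i * sgn_mem i z)
                        + (h - 1) * of_bool (T z = \<tau>))"
    proof (rule sum_mono)
      fix z
      show "of_bool (T z = \<tau>) * (\<Sum>i\<in>I. s i * sgn_mem i z)
          \<le> exp (- h) * exp (\<Sum>i\<in>I. s i * sgn_mem i z) + (h - 1) * of_bool (T z = \<tau>)"
        using exp_ge_add_one_self[of "(\<Sum>i\<in>I. s i * sgn_mem i z) - h"]
        by (auto simp: exp_diff exp_minus field_simps)
    qed
    also have "\<dots> = exp (- h) * (\<Sum>z\<in>Pow I. exp (\<Sum>i\<in>I. s i * sgn_mem i z))
                      + (h - 1) * (\<Sum>z\<in>Pow I. of_bool (T z = \<tau>))"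
      by (simp add: sum.distrib sum_distrib_left)
    also have "exp (- h) * (\<Sum>z\<in>Pow I. exp (\<Sum>i\<in>I. s i * sgn_mem i z))
        \<le> exp (- h) * (2 ^ card I * exp (\<mu>\<^sup>2 * card I))"
      by (intro mult_left_mono sum_exp_sgn_mem_le assms s) auto
    also have "\<dots> = 2 ^ card I / K"
    proof -
      have "exp h = K * exp (\<mu>\<^sup>2 * card I)" using K by (simp add: h_def exp_add)
      then show ?thesis using K by (simp add: exp_minus field_simps)
    qed
    finally show ?thesis by simp
  qed
  have cnt: "(\<Sum>\<tau>\<in>\<Omega>. \<Sum>z\<in>Pow I. of_bool (T z = \<tau>)) = (2 ^ card I :: real)"
  proof -
    have "(\<Sum>\<tau>\<in>\<Omega>. \<Sum>z\<in>Pow I. of_bool (T z = \<tau>)) = (\<Sum>z\<in>Pow I. \<Sum>\<tau>\<in>\<Omega>. of_bool (T z = \<tau>) :: real)"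
      by (rule sum.swap)
    also have "\<dots> = (\<Sum>z\<in>Pow I. 1)"
      using assms(2,4) by (intro sum.cong) (auto simp: of_bool_def)
    finally show ?thesis using assms(1) by (simp add: card_Pow)
  qed
  have "\<mu> * (\<Sum>\<tau>\<in>\<Omega>. \<Sum>i\<in>I. \<bar>\<Sum>z\<in>Pow I. of_bool (T z = \<tau>) * sgn_mem i z\<bar>)
      \<le> (\<Sum>\<tau>\<in>\<Omega>. 2 ^ card I / K + (h - 1) * (\<Sum>z\<in>Pow I. of_bool (T z = \<tau>)))"
    unfolding sum_distrib_left[of \<mu>] using leaf by (intro sum_mono) (simp add: sum_distrib_left)
  also have "\<dots> = 2 ^ card I + (h - 1) * 2 ^ card I"
    unfolding sum.distrib sum_distrib_left[symmetric] cnt using K by (simp add: K_def)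
  finally show ?thesis by (simp add: h_def K_def algebra_simps)
qed

text \<open>The pair \<open>(D, z)\<close> encodes the disjoint inputs \<open>z \<inter> D\<close> and \<open>z - D\<close>. Once the
  other elements are fixed, the weight of the rectangle is a product \<open>s\<^sub>a t\<^sub>b\<close> in the bits \<open>a\<close>, \<open>b\<close> at
  \<open>i\<close>, and \<open>s\<^sub>1 t\<^sub>1\<close> (both hold \<open>i\<close>) is bounded below through \<open>s\<^sub>0 t\<^sub>0\<close>, \<open>s\<^sub>0 t\<^sub>1\<close>, \<open>s\<^sub>1 t\<^sub>0\<close>, the
  weights of disjoint inputs.\<close>

lemma rectangle_cut_paste:
  fixes S T :: "'c set \<Rightarrow> bool"
  assumes "finite I" "i \<in> I"
  defines "R \<equiv> \<lambda>x y. of_bool (S x \<and> T y) :: real"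
  shows "(\<Sum>D\<in>Pow I. \<Sum>z\<in>Pow I. R (z \<inter> D) (z - D))
      - (\<Sum>D\<in>Pow I. \<Sum>z\<in>Pow I. R (insert i (z \<inter> D)) (insert i (z - D)))
    \<le> 5 * (\<Sum>D\<in>Pow I. \<bar>\<Sum>z\<in>Pow I. R (z \<inter> D) (z - D) * sgn_mem i z\<bar>)"
proof -
  define J where "J = I - {i}"
  have I: "I = insert i J" and iJ: "i \<notin> J" and fJ: "finite J"
    using assms by (auto simp: J_def)
  note ins = sum_Pow_insert[OF fJ iJ, folded I]
  \<comment> \<open>Pair \<open>D \<subseteq> J\<close> with \<open>insert i D\<close>: for the
    former only the second set can receive \<open>i\<close>, for the latter only the first.\<close>
  have "(\<Sum>D\<in>Pow I. \<Sum>z\<in>Pow I. R (z \<inter> D) (z - D))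
      - (\<Sum>D\<in>Pow I. \<Sum>z\<in>Pow I. R (insert i (z \<inter> D)) (insert i (z - D)))
      - 5 * (\<Sum>D\<in>Pow I. \<bar>\<Sum>z\<in>Pow I. R (z \<inter> D) (z - D) * sgn_mem i z\<bar>)
    = (\<Sum>D\<in>Pow J.
        (\<Sum>z\<in>Pow I. R (z \<inter> D) (z - D)) + (\<Sum>z\<in>Pow I. R (z \<inter> insert i D) (z - insert i D))
        - ((\<Sum>z\<in>Pow I. R (insert i (z \<inter> D)) (insert i (z - D)))
          + (\<Sum>z\<in>Pow I. R (insert i (z \<inter> insert i D)) (insert i (z - insert i D))))
        - 5 * (\<bar>\<Sum>z\<in>Pow I. R (z \<inter> D) (z - D) * sgn_mem i z\<bar>
          + \<bar>\<Sum>z\<in>Pow I. R (z \<inter> insert i D) (z - insert i D) * sgn_mem i z\<bar>))"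
    unfolding ins[of "\<lambda>D. \<Sum>z\<in>Pow I. R (z \<inter> D) (z - D)"]
      ins[of "\<lambda>D. \<Sum>z\<in>Pow I. R (insert i (z \<inter> D)) (insert i (z - D))"]
      ins[of "\<lambda>D. \<bar>\<Sum>z\<in>Pow I. R (z \<inter> D) (z - D) * sgn_mem i z\<bar>"]
    by (simp only: sum_subtractf sum.distrib sum_distrib_left[symmetric])
  also have "\<dots> \<le> (\<Sum>D\<in>Pow J. 0)"
  proof (rule sum_mono)
    fix D assume "D \<in> Pow J"
    then have D: "D \<subseteq> J" and iD: "i \<notin> D" using iJ by auto
    define s0 s1 t0 t1 :: real where
      "s0 = (\<Sum>u\<in>Pow D. of_bool (S u))" and "s1 = (\<Sum>u\<in>Pow D. of_bool (S (insert i u)))" and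
      "t0 = (\<Sum>w\<in>Pow (J - D). of_bool (T w))" and "t1 = (\<Sum>w\<in>Pow (J - D). of_bool (T (insert i w)))"
    have nonneg: "0 \<le> s0" "0 \<le> s1" "0 \<le> t0" "0 \<le> t1"
      by (auto simp: s0_def s1_def t0_def t1_def intro: sum_nonneg)
    note split = sum_Pow_split[OF fJ D]
    have sg: "sgn_mem i z = -1" "sgn_mem i (insert i z) = 1" if "z \<subseteq> J" for z
      using that iJ by (auto simp: sgn_mem_def)
    have p00: "(\<Sum>z\<in>Pow J. R (z \<inter> D) (z - D)) = s0 * t0"
      and p10: "(\<Sum>z\<in>Pow J. R (insert i (z \<inter> D)) (z - D)) = s1 * t0"
      and p01: "(\<Sum>z\<in>Pow J. R (z \<inter> D) (insert i (z - D))) = s0 * t1"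
      and p11: "(\<Sum>z\<in>Pow J. R (insert i (z \<inter> D)) (insert i (z - D))) = s1 * t1"
      unfolding R_def s0_def s1_def t0_def t1_def of_bool_conj
      using split[of "\<lambda>u. of_bool (S u)" "\<lambda>w. of_bool (T w)"]
        split[of "\<lambda>u. of_bool (S (insert i u))" "\<lambda>w. of_bool (T w)"]
        split[of "\<lambda>u. of_bool (S u)" "\<lambda>w. of_bool (T (insert i w))"]
        split[of "\<lambda>u. of_bool (S (insert i u))" "\<lambda>w. of_bool (T (insert i w))"] by blast+
    have e1: "insert i z \<inter> D = z \<inter> D" "z \<inter> insert i D = z \<inter> D"
      "insert i z \<inter> insert i D = insert i (z \<inter> D)" "insert i z - insert i D = z - D"
      "z - insert i D = z - D" "insert i z - D = insert i (z - D)" if "z \<subseteq> J" for z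
      using that iJ iD by auto
    have a1: "(\<Sum>z\<in>Pow I. R (z \<inter> D) (z - D)) = s0 * t0 + s0 * t1"
      unfolding ins sum.distrib p00[symmetric] p01[symmetric]
      by (auto simp: e1 intro!: arg_cong2[where f = "(+)"] sum.cong)
    have a2: "(\<Sum>z\<in>Pow I. R (z \<inter> insert i D) (z - insert i D)) = s0 * t0 + s1 * t0"
      unfolding ins sum.distrib p00[symmetric] p10[symmetric]
      by (auto simp: e1 intro!: arg_cong2[where f = "(+)"] sum.cong)
    \<comment> \<open>With \<open>i\<close> planted on both sides, neither \<open>D\<close> nor
      \<open>z\<close> decides where \<open>i\<close> goes, so \<open>z\<close> and
      \<open>insert i z\<close> count the same.\<close>
    have a3: "(\<Sum>z\<in>Pow I. R (insert i (z \<inter> D)) (insert i (z - D))) = 2 * (s1 * t1)"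
      unfolding ins sum.distrib mult_2 p11[symmetric]
      by (auto simp: e1 intro!: arg_cong2[where f = "(+)"] sum.cong)
    have a4: "(\<Sum>z\<in>Pow I. R (insert i (z \<inter> insert i D)) (insert i (z - insert i D))) = 2 * (s1 * t1)"
      unfolding ins sum.distrib mult_2 p11[symmetric]
      by (auto simp: e1 intro!: arg_cong2[where f = "(+)"] sum.cong)
    have a5: "(\<Sum>z\<in>Pow I. R (z \<inter> D) (z - D) * sgn_mem i z) = s0 * t1 - s0 * t0"
      unfolding ins p00[symmetric] p01[symmetric] sum_subtractf[symmetric]
      by (auto simp: e1 sg intro!: sum.cong)
    have a6: "(\<Sum>z\<in>Pow I. R (z \<inter> insert i D) (z - insert i D) * sgn_mem i z) = s1 * t0 - s0 * t0"
      unfolding ins p00[symmetric] p10[symmetric] sum_subtractf[symmetric]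
      by (auto simp: e1 sg intro!: sum.cong)
    \<comment> \<open>If \<open>s1 \<le> s0\<close>, change one factor of \<open>s0 * t0\<close> at
      a time and enlarge the remaining \<open>s1\<close> to \<open>s0\<close>; otherwise
      \<open>s1 * t1 \<ge> s0 * t1\<close> and the first error alone suffices.\<close>
    have "s0 * t0 - s1 * t1 \<le> \<bar>s0 * t1 - s0 * t0\<bar> + \<bar>s1 * t0 - s0 * t0\<bar>"
    proof (cases "s1 \<le> s0")
      case True
      have "s0 * t0 - s1 * t1 = (s0 * t0 - s1 * t0) + s1 * (t0 - t1)" by (simp add: algebra_simps)
      also have "s1 * (t0 - t1) \<le> s1 * \<bar>t0 - t1\<bar>" using nonneg by (intro mult_left_mono) auto
      also have "\<dots> \<le> s0 * \<bar>t0 - t1\<bar>" using True by (intro mult_right_mono) auto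
      also have "\<dots> = \<bar>s0 * t1 - s0 * t0\<bar>"
        using nonneg by (simp add: right_diff_distrib[symmetric] abs_mult abs_minus_commute)
      finally show ?thesis by linarith
    next
      case False
      then have "s0 * t1 \<le> s1 * t1" using nonneg by (intro mult_right_mono) auto
      then show ?thesis by linarith
    qed
    \<comment> \<open>The disjoint weights total \<open>2 * s0 * t0 + s0 * t1 + s1 * t0\<close>, at
      most \<open>4 * s0 * t0 + e1 + e2\<close>, against \<open>4 * s1 * t1\<close> for the
      intersecting ones. Four times the previous inequality plus these errors gives the factor
      5.\<close>
    moreover define e1 e2 where "e1 = \<bar>s0 * t1 - s0 * t0\<bar>" and "e2 = \<bar>s1 * t0 - s0 * t0\<bar>"
    moreover have "s0 * t1 - s0 * t0 \<le> e1" "s1 * t0 - s0 * t0 \<le> e2"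
      by (simp_all add: e1_def e2_def)
    ultimately show "(\<Sum>z\<in>Pow I. R (z \<inter> D) (z - D)) + (\<Sum>z\<in>Pow I. R (z \<inter> insert i D) (z - insert i D))
        - ((\<Sum>z\<in>Pow I. R (insert i (z \<inter> D)) (insert i (z - D)))
          + (\<Sum>z\<in>Pow I. R (insert i (z \<inter> insert i D)) (insert i (z - insert i D))))
        - 5 * (\<bar>\<Sum>z\<in>Pow I. R (z \<inter> D) (z - D) * sgn_mem i z\<bar>
          + \<bar>\<Sum>z\<in>Pow I. R (z \<inter> insert i D) (z - insert i D) * sgn_mem i z\<bar>) \<le> 0"
      unfolding a1 a2 a3 a4 a5 a6 e1_def[symmetric] e2_def[symmetric]
      by (simp add: algebra_simps)
  qed
  finally show ?thesis by simp
qed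

section \<open>Summing over all transcripts\<close>

lemma four_power: "(4 :: real) ^ n = 2 ^ n * 2 ^ n"
  by (simp add: power_mult_distrib[symmetric])

lemma sum_swap3:
  "(\<Sum>x\<in>A. \<Sum>y\<in>B. \<Sum>z\<in>C. f x y z) = (\<Sum>z\<in>C. \<Sum>x\<in>A. \<Sum>y\<in>B. f x y z)"
proof -
  have "(\<Sum>x\<in>A. \<Sum>y\<in>B. \<Sum>z\<in>C. f x y z) = (\<Sum>x\<in>A. \<Sum>z\<in>C. \<Sum>y\<in>B. f x y z)"
    by (intro sum.cong refl sum.swap)
  also have "\<dots> = (\<Sum>z\<in>C. \<Sum>x\<in>A. \<Sum>y\<in>B. f x y z)" by (rule sum.swap)
  finally show ?thesis .
qed

text \<open>The fibre of each transcript is a rectangle, so \<open>rectangle_cut_paste\<close>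
  bounds the agreement with the labels \<open>v\<close> lost by planting \<open>i\<close> through
  correlations with membership of \<open>i\<close>. For each \<open>D\<close> the level-1 inequality
  bounds these, summed over all \<open>i\<close> and all transcripts.\<close>

lemma sum_agreement_shift_le:
  fixes tr :: "'c set \<Rightarrow> 'c set \<Rightarrow> 't" and \<mu> :: real
  assumes fin: "finite I" "finite \<Omega>" "\<Omega> \<noteq> {}" and \<mu>: "0 < \<mu>" "\<mu> \<le> 1"
    and tr: "\<And>x y. x \<subseteq> I \<Longrightarrow> y \<subseteq> I \<Longrightarrow> tr x y \<in> \<Omega>"
    and rect: "\<And>\<tau>. \<exists>S T. \<forall>x y. tr x y = \<tau> \<longleftrightarrow> S x \<and> T y"
  shows "\<mu> * ((\<Sum>i\<in>I. \<Sum>D\<in>Pow I. \<Sum>z\<in>Pow I. of_bool (out (tr (z \<inter> D) (z - D)) = v i))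
      - (\<Sum>i\<in>I. \<Sum>D\<in>Pow I. \<Sum>z\<in>Pow I.
          of_bool (out (tr (insert i (z \<inter> D)) (insert i (z - D))) = v i)))
    \<le> 5 * 4 ^ card I * (ln (card \<Omega>) + \<mu>\<^sup>2 * card I)"
proof -
  define E where "E D i \<tau> = \<bar>\<Sum>z\<in>Pow I. of_bool (tr (z \<inter> D) (z - D) = \<tau>) * sgn_mem i z\<bar>" for D i \<tau>
  have by_leaf: "(\<Sum>D\<in>Pow I. \<Sum>z\<in>Pow I. of_bool (out (tr (a D z) (c D z)) = w) :: real)
      = (\<Sum>\<tau>\<in>\<Omega>. of_bool (out \<tau> = w) * (\<Sum>D\<in>Pow I. \<Sum>z\<in>Pow I. of_bool (tr (a D z) (c D z) = \<tau>)))"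
    if sub: "\<And>D z. D \<in> Pow I \<Longrightarrow> z \<in> Pow I \<Longrightarrow> a D z \<subseteq> I \<and> c D z \<subseteq> I"
    for a c :: "'c set \<Rightarrow> 'c set \<Rightarrow> 'c set" and w
  proof -
    have "(\<Sum>D\<in>Pow I. \<Sum>z\<in>Pow I. of_bool (out (tr (a D z) (c D z)) = w) :: real)
      = (\<Sum>D\<in>Pow I. \<Sum>z\<in>Pow I. \<Sum>\<tau>\<in>\<Omega>. of_bool (out \<tau> = w) * of_bool (tr (a D z) (c D z) = \<tau>))"
    proof (intro sum.cong refl)
      fix D z assume "D \<in> Pow I" "z \<in> Pow I"
      then have "tr (a D z) (c D z) \<in> \<Omega>" by (intro tr) (simp_all add: sub)
      then have "(\<Sum>\<tau>\<in>\<Omega>. of_bool (out \<tau> = w) * of_bool (tr (a D z) (c D z) = \<tau>) :: real)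
          = (\<Sum>\<tau>\<in>{tr (a D z) (c D z)}. of_bool (out \<tau> = w))"
        using fin(2) by (intro sum.mono_neutral_cong_right) auto
      then show "of_bool (out (tr (a D z) (c D z)) = w)
          = (\<Sum>\<tau>\<in>\<Omega>. of_bool (out \<tau> = w) * of_bool (tr (a D z) (c D z) = \<tau>) :: real)"
        by simp
    qed
    also have "\<dots> = (\<Sum>\<tau>\<in>\<Omega>. \<Sum>D\<in>Pow I. \<Sum>z\<in>Pow I.
        of_bool (out \<tau> = w) * of_bool (tr (a D z) (c D z) = \<tau>))"
      by (rule sum_swap3)
    finally show ?thesis by (simp only: sum_distrib_left)
  qed
  have "(\<Sum>i\<in>I. \<Sum>D\<in>Pow I. \<Sum>z\<in>Pow I. of_bool (out (tr (z \<inter> D) (z - D)) = v i))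
      - (\<Sum>i\<in>I. \<Sum>D\<in>Pow I. \<Sum>z\<in>Pow I.
          of_bool (out (tr (insert i (z \<inter> D)) (insert i (z - D))) = v i))
    = (\<Sum>i\<in>I. \<Sum>\<tau>\<in>\<Omega>. of_bool (out \<tau> = v i) *
        ((\<Sum>D\<in>Pow I. \<Sum>z\<in>Pow I. of_bool (tr (z \<inter> D) (z - D) = \<tau>))
        - (\<Sum>D\<in>Pow I. \<Sum>z\<in>Pow I. of_bool (tr (insert i (z \<inter> D)) (insert i (z - D)) = \<tau>))) :: real)"
    unfolding sum_subtractf[symmetric, where A = I] right_diff_distrib sum_subtractf[where A = \<Omega>]
    by (intro sum.cong refl arg_cong2[where f = "(-)"] by_leaf) auto
  also have "\<dots> \<le> (\<Sum>i\<in>I. \<Sum>\<tau>\<in>\<Omega>. 5 * (\<Sum>D\<in>Pow I. E D i \<tau>))"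
  proof (intro sum_mono)
    fix i \<tau> assume "i \<in> I" "\<tau> \<in> \<Omega>"
    obtain S T where ST: "\<And>x y. tr x y = \<tau> \<longleftrightarrow> S x \<and> T y" using rect by metis
    have le: "(\<Sum>D\<in>Pow I. \<Sum>z\<in>Pow I. of_bool (tr (z \<inter> D) (z - D) = \<tau>))
        - (\<Sum>D\<in>Pow I. \<Sum>z\<in>Pow I. of_bool (tr (insert i (z \<inter> D)) (insert i (z - D)) = \<tau>))
        \<le> 5 * (\<Sum>D\<in>Pow I. E D i \<tau>)"
      unfolding E_def ST by (rule rectangle_cut_paste[OF fin(1) \<open>i \<in> I\<close>])
    have "0 \<le> (\<Sum>D\<in>Pow I. E D i \<tau>)" by (auto simp: E_def intro: sum_nonneg)
    with le show "of_bool (out \<tau> = v i) *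
        ((\<Sum>D\<in>Pow I. \<Sum>z\<in>Pow I. of_bool (tr (z \<inter> D) (z - D) = \<tau>))
        - (\<Sum>D\<in>Pow I. \<Sum>z\<in>Pow I. of_bool (tr (insert i (z \<inter> D)) (insert i (z - D)) = \<tau>)))
        \<le> 5 * (\<Sum>D\<in>Pow I. E D i \<tau>)"
      by (cases "out \<tau> = v i") auto
  qed
  also have "\<dots> = 5 * (\<Sum>D\<in>Pow I. \<Sum>\<tau>\<in>\<Omega>. \<Sum>i\<in>I. E D i \<tau>)"
  proof -
    have "(\<Sum>i\<in>I. \<Sum>\<tau>\<in>\<Omega>. \<Sum>D\<in>Pow I. E D i \<tau>) = (\<Sum>D\<in>Pow I. \<Sum>i\<in>I. \<Sum>\<tau>\<in>\<Omega>. E D i \<tau>)"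
      by (rule sum_swap3)
    also have "\<dots> = (\<Sum>D\<in>Pow I. \<Sum>\<tau>\<in>\<Omega>. \<Sum>i\<in>I. E D i \<tau>)"
      by (intro sum.cong refl sum.swap)
    finally show ?thesis by (simp only: sum_distrib_left[symmetric])
  qed
  finally have "\<mu> * ((\<Sum>i\<in>I. \<Sum>D\<in>Pow I. \<Sum>z\<in>Pow I. of_bool (out (tr (z \<inter> D) (z - D)) = v i))
      - (\<Sum>i\<in>I. \<Sum>D\<in>Pow I. \<Sum>z\<in>Pow I.
          of_bool (out (tr (insert i (z \<inter> D)) (insert i (z - D))) = v i)))
    \<le> \<mu> * (5 * (\<Sum>D\<in>Pow I. \<Sum>\<tau>\<in>\<Omega>. \<Sum>i\<in>I. E D i \<tau>))"
    using \<mu>(1) by (intro mult_left_mono) auto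
  also have "\<dots> = 5 * (\<Sum>D\<in>Pow I. \<mu> * (\<Sum>\<tau>\<in>\<Omega>. \<Sum>i\<in>I. E D i \<tau>))"
    by (simp add: sum_distrib_left mult_ac)
  also have "\<dots> \<le> 5 * (\<Sum>D\<in>Pow I. 2 ^ card I * (ln (card \<Omega>) + \<mu>\<^sup>2 * card I))"
    unfolding E_def
  proof (intro mult_left_mono sum_mono)
    fix D assume "D \<in> Pow I"
    show "\<mu> * (\<Sum>\<tau>\<in>\<Omega>. \<Sum>i\<in>I. \<bar>\<Sum>z\<in>Pow I. of_bool (tr (z \<inter> D) (z - D) = \<tau>) * sgn_mem i z\<bar>)
        \<le> 2 ^ card I * (ln (card \<Omega>) + \<mu>\<^sup>2 * card I)"
    proof (rule sum_level_one_le[OF fin _ \<mu>])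
      show "tr (z \<inter> D) (z - D) \<in> \<Omega>" if "z \<subseteq> I" for z
        using that by (intro tr) auto
    qed
  qed simp
  also have "\<dots> = 5 * 4 ^ card I * (ln (card \<Omega>) + \<mu>\<^sup>2 * card I)"
    using fin(1) by (simp only: sum_constant card_Pow four_power mult.assoc of_nat_power of_nat_numeral)
  finally show ?thesis .
qed

subsection \<open>Protocols\<close>

text \<open>The result announced at a leaf may depend on a private input, so the bits sent do not
  determine it. Appending one bit \<open>g\<close> of the result makes that bit a function of the
  transcript and keeps the fibres rectangles.\<close>

primrec transcript :: "('o \<Rightarrow> bool) \<Rightarrow> ('a, 'b, 'o) protocol \<Rightarrow> 'a \<Rightarrow> 'b \<Rightarrow> bool list" where
  "transcript g (Alice_Out f) x y = [g (f x)]"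
| "transcript g (Bob_Out f) x y = [g (f y)]"
| "transcript g (Alice_Bit q l r) x y =
    q x # (if q x then transcript g l x y else transcript g r x y)"
| "transcript g (Bob_Bit q l r) x y =
    q y # (if q y then transcript g l x y else transcript g r x y)"

lemma length_transcript: "length (transcript g \<pi> x y) = Suc (bits \<pi> x y)"
  by (induction \<pi>) auto

lemma transcript_neq_Nil: "transcript g \<pi> x y \<noteq> []"
  by (cases \<pi>) auto

lemma last_transcript: "last (transcript g \<pi> x y) = g (run \<pi> x y)"
  by (induction \<pi>) (auto simp: transcript_neq_Nil)

text \<open>Every entry depends on the input of one party only. By induction on the tree, the first
  entry constrains its sender, and the rest is a rectangle of the subtree it selects.\<close>

lemma transcript_rectangle: "\<exists>S T. \<forall>x y. transcript g \<pi> x y = \<tau> \<longleftrightarrow> S x \<and> T y"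
proof (induction \<pi> arbitrary: \<tau>)
  case (Alice_Out f)
  show ?case by (rule exI[of _ "\<lambda>x. [g (f x)] = \<tau>"], rule exI[of _ "\<lambda>_. True"]) simp
next
  case (Bob_Out f)
  show ?case by (rule exI[of _ "\<lambda>_. True"], rule exI[of _ "\<lambda>y. [g (f y)] = \<tau>"]) simp
next
  case (Alice_Bit q l r)
  obtain S1 T1 where l: "\<forall>x y. transcript g l x y = tl \<tau> \<longleftrightarrow> S1 x \<and> T1 y"
    using Alice_Bit.IH(1)[of "tl \<tau>"] by blast
  obtain S2 T2 where r: "\<forall>x y. transcript g r x y = tl \<tau> \<longleftrightarrow> S2 x \<and> T2 y"
    using Alice_Bit.IH(2)[of "tl \<tau>"] by blast
  \<comment> \<open>For empty \<open>\<tau>\<close> the values of \<open>hd\<close> and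
    \<open>tl\<close> are irrelevant: the conjunct \<open>\<tau> \<noteq> []\<close> makes the right
    side false, and transcripts are nonempty.\<close>
  have "\<forall>x y. transcript g (Alice_Bit q l r) x y = \<tau> \<longleftrightarrow>
      (\<tau> \<noteq> [] \<and> q x = hd \<tau> \<and> (if hd \<tau> then S1 x else S2 x)) \<and> (if hd \<tau> then T1 y else T2 y)"
    using l r by (cases \<tau>) auto
  then show ?case
    by (intro exI[of _ "\<lambda>x. \<tau> \<noteq> [] \<and> q x = hd \<tau> \<and> (if hd \<tau> then S1 x else S2 x)"]
        exI[of _ "\<lambda>y. if hd \<tau> then T1 y else T2 y"])
next
  case (Bob_Bit q l r)
  obtain S1 T1 where l: "\<forall>x y. transcript g l x y = tl \<tau> \<longleftrightarrow> S1 x \<and> T1 y"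
    using Bob_Bit.IH(1)[of "tl \<tau>"] by blast
  obtain S2 T2 where r: "\<forall>x y. transcript g r x y = tl \<tau> \<longleftrightarrow> S2 x \<and> T2 y"
    using Bob_Bit.IH(2)[of "tl \<tau>"] by blast
  have "\<forall>x y. transcript g (Bob_Bit q l r) x y = \<tau> \<longleftrightarrow>
      (if hd \<tau> then S1 x else S2 x) \<and> (\<tau> \<noteq> [] \<and> q y = hd \<tau> \<and> (if hd \<tau> then T1 y else T2 y))"
    using l r by (cases \<tau>) auto
  then show ?case
    by (intro exI[of _ "\<lambda>x. if hd \<tau> then S1 x else S2 x"]
        exI[of _ "\<lambda>y. \<tau> \<noteq> [] \<and> q y = hd \<tau> \<and> (if hd \<tau> then T1 y else T2 y)"])
qed

section \<open>Counting transcripts and averaging over the coins\<close>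

lemma ln_card_bool_lists_le:
  "ln (card {\<tau> :: bool list. length \<tau> \<le> m}) \<le> real (Suc m)"
proof -
  have "card {\<tau> :: bool list. length \<tau> \<le> m} = (\<Sum>i\<le>m. 2 ^ i)"
    using card_lists_length_le[of "UNIV :: bool set" m] by simp
  also have "\<dots> \<le> 2 ^ Suc m"
    by (induction m) auto
  finally have le: "card {\<tau> :: bool list. length \<tau> \<le> m} \<le> 2 ^ Suc m" .
  have fin: "finite {\<tau> :: bool list. length \<tau> \<le> m}"
    using finite_lists_length_le[of "UNIV :: bool set" m] by simp
  moreover have "{\<tau> :: bool list. length \<tau> \<le> m} \<noteq> {}" by (auto intro: exI[of _ "[]"])
  ultimately have "0 < card {\<tau> :: bool list. length \<tau> \<le> m}" by (simp add: card_gt_0_iff)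
  moreover have "real (card {\<tau> :: bool list. length \<tau> \<le> m}) \<le> real (2 ^ Suc m)"
    using le by (simp only: of_nat_le_iff)
  ultimately have "ln (card {\<tau> :: bool list. length \<tau> \<le> m}) \<le> ln (real (2 ^ Suc m))"
    by (subst ln_le_cancel_iff) simp_all
  also have "\<dots> = Suc m * ln 2" using ln_realpow[of 2 "Suc m"] by simp
  also have "\<dots> \<le> Suc m * 1" using ln_le_minus_one[of "2::real"] by (simp add: mult_left_mono)
  finally show ?thesis by simp
qed

text \<open>The bit \<open>g\<close> is to tell which of \<open>G1\<close> and \<open>G2\<close>
  contains the common element \<open>i\<close>. On the disjoint inputs the answer cannot depend on
  \<open>i\<close>, so it is wrong for exactly \<open>N\<close> of the \<open>2 * N\<close>
  elements; planting \<open>i\<close> removes few of these wrong answers.\<close>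

lemma deterministic_successes_le:
  fixes \<pi> :: "('a, 'b, 'o) protocol" and ex :: "'c set \<Rightarrow> 'a" and ey :: "'c set \<Rightarrow> 'b"
  assumes fin: "finite G1" "finite G2" and disj: "G1 \<inter> G2 = {}"
    and card: "card G1 = N" "card G2 = N"
    and bits: "\<And>x y. x \<subseteq> G1 \<union> G2 \<Longrightarrow> y \<subseteq> G1 \<union> G2 \<Longrightarrow> bits \<pi> (ex x) (ey y) \<le> b"
  shows "(\<Sum>i\<in>G1 \<union> G2. \<Sum>D\<in>Pow (G1 \<union> G2). \<Sum>z\<in>Pow (G1 \<union> G2).
      of_bool (g (run \<pi> (ex (insert i (z \<inter> D))) (ey (insert i (z - D)))) \<longleftrightarrow> i \<in> G1))
    \<le> 4 ^ (2 * N) * (7 / 6 * real N + 300 * (real b + 2))"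
proof -
  define I where "I = G1 \<union> G2"
  define tr where "tr x y = transcript g \<pi> (ex x) (ey y)" for x y
  \<comment> \<open>The appended answer raises the length to \<open>Suc b\<close>, and
    \<open>ln_card_bool_lists_le\<close> then yields \<open>b + 2\<close>.\<close>
  define \<Omega> where "\<Omega> = {\<tau> :: bool list. length \<tau> \<le> Suc b}"
  have fI: "finite I" and cI: "card I = 2 * N"
    using fin disj card by (auto simp: I_def card_Un_disjoint)
  have \<Omega>: "finite \<Omega>" "\<Omega> \<noteq> {}"
    using finite_lists_length_le[of "UNIV :: bool set" "Suc b"]
    by (auto simp: \<Omega>_def intro: exI[of _ "[]"])
  have out: "last (tr x y) = g (run \<pi> (ex x) (ey y))" for x y
    by (simp add: tr_def last_transcript)
  \<comment> \<open>Both count wrong answers, \<open>A\<close> before and \<open>B\<close> after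
    \<open>i\<close> is planted: true is the answer that stands for \<open>G1\<close>.\<close>
  define A B :: real where
    "A = (\<Sum>i\<in>I. \<Sum>D\<in>Pow I. \<Sum>z\<in>Pow I. of_bool (last (tr (z \<inter> D) (z - D)) \<longleftrightarrow> i \<in> G2))" and
    "B = (\<Sum>i\<in>I. \<Sum>D\<in>Pow I. \<Sum>z\<in>Pow I.
          of_bool (last (tr (insert i (z \<inter> D)) (insert i (z - D))) \<longleftrightarrow> i \<in> G2))"
  \<comment> \<open>With \<open>\<mu> = 1 / 60\<close> the quadratic term costs
    \<open>5 * \<mu> * 2 * N = N / 6\<close>, small enough that \<open>N + N / 6\<close> stays below
    \<open>4 / 3 * N\<close>, two thirds of \<open>2 * N\<close>.\<close>
  have "1 / 60 * (A - B) \<le> 5 * 4 ^ card I * (ln (card \<Omega>) + (1 / 60)\<^sup>2 * card I)"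
    unfolding A_def B_def
  proof (rule sum_agreement_shift_le[OF fI \<Omega>])
    show "tr x y \<in> \<Omega>" if "x \<subseteq> I" "y \<subseteq> I" for x y
      using bits[of x y] that by (simp add: tr_def \<Omega>_def I_def length_transcript)
    show "\<exists>S T. \<forall>x y. tr x y = \<tau> \<longleftrightarrow> S x \<and> T y" for \<tau>
    proof -
      obtain S T where "\<And>x y. transcript g \<pi> x y = \<tau> \<longleftrightarrow> S x \<and> T y"
        using transcript_rectangle[of g \<pi> \<tau>] by blast
      then have "\<forall>x y. tr x y = \<tau> \<longleftrightarrow> (S \<circ> ex) x \<and> (T \<circ> ey) y" by (simp add: tr_def)
      then show ?thesis by blast
    qed
  qed auto
  also have "\<dots> \<le> 5 * 4 ^ card I * (real b + 2 + (1 / 60)\<^sup>2 * card I)"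
    using ln_card_bool_lists_le[of "Suc b"] by (intro mult_left_mono) (auto simp: \<Omega>_def)
  finally have AB: "A - B \<le> 4 ^ (2 * N) * (300 * (real b + 2) + real N / 6)"
    by (simp add: cI power2_eq_square field_simps)
  have A: "A = 4 ^ (2 * N) * real N"
  proof -
    have flip: "(\<Sum>D\<in>Pow I. \<Sum>z\<in>Pow I. of_bool (last (tr (z \<inter> D) (z - D)) \<longleftrightarrow> True))
        + (\<Sum>D\<in>Pow I. \<Sum>z\<in>Pow I. of_bool (last (tr (z \<inter> D) (z - D)) \<longleftrightarrow> False)) = (4 ^ (2 * N) :: real)"
    proof -
      have "(\<Sum>D\<in>Pow I. \<Sum>z\<in>Pow I. of_bool (last (tr (z \<inter> D) (z - D)) \<longleftrightarrow> True))
        + (\<Sum>D\<in>Pow I. \<Sum>z\<in>Pow I. of_bool (last (tr (z \<inter> D) (z - D)) \<longleftrightarrow> False))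
        = (\<Sum>D\<in>Pow I. \<Sum>z\<in>Pow I. 1 :: real)"
        unfolding sum.distrib[symmetric] by (intro sum.cong) auto
      also have "\<dots> = 4 ^ (2 * N)"
        using fI by (simp add: card_Pow cI four_power mult_ac)
      finally show ?thesis .
    qed
    \<comment> \<open>The inner sums do not depend on \<open>i\<close>. Both sets have
      \<open>N\<close> elements, so the two answers together cover every pair \<open>(D, z)\<close>
      exactly \<open>N\<close> times.\<close>
    have "A = (\<Sum>i\<in>G1. \<Sum>D\<in>Pow I. \<Sum>z\<in>Pow I. of_bool (last (tr (z \<inter> D) (z - D)) \<longleftrightarrow> False))
        + (\<Sum>i\<in>G2. \<Sum>D\<in>Pow I. \<Sum>z\<in>Pow I. of_bool (last (tr (z \<inter> D) (z - D)) \<longleftrightarrow> True))"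
      unfolding A_def I_def[symmetric]
      unfolding I_def sum.union_disjoint[OF fin disj]
      using disj by (intro arg_cong2[where f = "(+)"] sum.cong) (auto simp: I_def)
    also have "\<dots> = real N * 4 ^ (2 * N)"
      unfolding flip[symmetric] by (simp add: card distrib_left)
    finally show ?thesis by simp
  qed
  have "(\<Sum>i\<in>I. \<Sum>D\<in>Pow I. \<Sum>z\<in>Pow I.
      of_bool (last (tr (insert i (z \<inter> D)) (insert i (z - D))) \<longleftrightarrow> i \<in> G1)) + B
      = (\<Sum>i\<in>I. \<Sum>D\<in>Pow I. \<Sum>z\<in>Pow I. 1)"
    unfolding B_def sum.distrib[symmetric]
  proof (intro sum.cong refl)
    fix i D z assume "i \<in> I"
    then have "i \<in> G2 \<longleftrightarrow> i \<notin> G1" using disj by (auto simp: I_def)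
    then show "of_bool (last (tr (insert i (z \<inter> D)) (insert i (z - D))) \<longleftrightarrow> i \<in> G1)
        + of_bool (last (tr (insert i (z \<inter> D)) (insert i (z - D))) \<longleftrightarrow> i \<in> G2) = (1 :: real)"
      by simp
  qed
  also have "\<dots> = 4 ^ (2 * N) * (2 * real N)"
    using fI by (simp add: card_Pow cI four_power mult_ac)
  finally show ?thesis
    using AB A by (simp add: out I_def algebra_simps)
qed

text \<open>Averaging: the success probabilities, summed over all planted inputs, are the
  expectation of the number of successes of a deterministic protocol, which
  \<open>deterministic_successes_le\<close> bounds.\<close>

lemma communication_lower_bound:
  fixes R :: "('a, 'b, 'o) protocol measure" and ex :: "'c set \<Rightarrow> 'a" and ey :: "'c set \<Rightarrow> 'b"
  assumes prob: "prob_space R"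
    and fin: "finite G1" "finite G2" and disj: "G1 \<inter> G2 = {}"
    and card: "card G1 = N" "card G2 = N"
    and bits: "\<And>\<pi> x y. \<pi> \<in> space R \<Longrightarrow> x \<subseteq> G1 \<union> G2 \<Longrightarrow> y \<subseteq> G1 \<union> G2 \<Longrightarrow> bits \<pi> (ex x) (ey y) \<le> b"
    and success: "\<And>i x y. x \<subseteq> G1 \<union> G2 \<Longrightarrow> y \<subseteq> G1 \<union> G2 \<Longrightarrow> x \<inter> y = {i} \<Longrightarrow>
      measure R {\<pi> \<in> space R. good i (run \<pi> (ex x) (ey y))} \<ge> 2 / 3"
    and separated: "\<And>i j p. i \<in> G1 \<Longrightarrow> j \<in> G2 \<Longrightarrow> good i p \<Longrightarrow> \<not> good j p"
  shows "real N \<le> 1800 * (real b + 2)"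
proof -
  interpret prob_space R by (rule prob)
  define I where "I = G1 \<union> G2"
  have fI: "finite I" and cI: "card I = 2 * N"
    using fin disj card by (auto simp: I_def card_Un_disjoint)
  define ev where "ev i D z =
    {\<pi> \<in> space R. good i (run \<pi> (ex (insert i (z \<inter> D))) (ey (insert i (z - D))))}" for i D z
  define bound where "bound = 4 ^ (2 * N) * (7 / 6 * real N + 300 * (real b + 2))"
  have ev: "2 / 3 \<le> measure R (ev i D z)" if "i \<in> I" "D \<in> Pow I" "z \<in> Pow I" for i D z
    unfolding ev_def using that by (intro success) (auto simp: I_def)
  \<comment> \<open>A non-measurable event would have measure 0, not at least 2/3.\<close>
  have sets: "ev i D z \<in> sets R" if "i \<in> I" "D \<in> Pow I" "z \<in> Pow I" for i D z
    using ev[OF that] measure_notin_sets[of "ev i D z" R] by fastforce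
  have "4 ^ (2 * N) * (4 / 3 * real N) = (\<Sum>i\<in>I. \<Sum>D\<in>Pow I. \<Sum>z\<in>Pow I. 2 / 3 :: real)"
    using fI by (simp add: card_Pow cI four_power mult_ac)
  also have "\<dots> \<le> (\<Sum>i\<in>I. \<Sum>D\<in>Pow I. \<Sum>z\<in>Pow I. measure R (ev i D z))"
    using ev by (intro sum_mono)
  also have "\<dots> = (\<Sum>i\<in>I. \<Sum>D\<in>Pow I. \<Sum>z\<in>Pow I. \<integral>\<pi>. indicator (ev i D z) \<pi> \<partial>R)"
    using sets by (intro sum.cong refl) simp
  also have "\<dots> = (\<integral>\<pi>. (\<Sum>i\<in>I. \<Sum>D\<in>Pow I. \<Sum>z\<in>Pow I. indicator (ev i D z) \<pi>) \<partial>R)"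
  proof -
    have int: "integrable R (\<lambda>\<pi>. indicator (ev i D z) \<pi> :: real)" if "i \<in> I" "D \<in> Pow I" "z \<in> Pow I" for i D z
      using sets[OF that] by (simp add: emeasure_eq_measure)
    have "(\<integral>\<pi>. (\<Sum>i\<in>I. \<Sum>D\<in>Pow I. \<Sum>z\<in>Pow I. indicator (ev i D z) \<pi> :: real) \<partial>R)
        = (\<Sum>i\<in>I. \<integral>\<pi>. (\<Sum>D\<in>Pow I. \<Sum>z\<in>Pow I. indicator (ev i D z) \<pi>) \<partial>R)"
      by (rule Bochner_Integration.integral_sum) (intro Bochner_Integration.integrable_sum int)
    also have "\<dots> = (\<Sum>i\<in>I. \<Sum>D\<in>Pow I. \<integral>\<pi>. (\<Sum>z\<in>Pow I. indicator (ev i D z) \<pi>) \<partial>R)"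
      by (intro sum.cong refl Bochner_Integration.integral_sum Bochner_Integration.integrable_sum int)
    also have "\<dots> = (\<Sum>i\<in>I. \<Sum>D\<in>Pow I. \<Sum>z\<in>Pow I. \<integral>\<pi>. indicator (ev i D z) \<pi> \<partial>R)"
      by (intro sum.cong refl Bochner_Integration.integral_sum int)
    finally show ?thesis by simp
  qed
  also have "\<dots> \<le> (\<integral>\<pi>. bound \<partial>R)"
  proof (rule integral_mono)
    show "integrable R (\<lambda>\<pi>. \<Sum>i\<in>I. \<Sum>D\<in>Pow I. \<Sum>z\<in>Pow I. indicator (ev i D z) \<pi> :: real)"
      using sets by (intro Bochner_Integration.integrable_sum) (simp add: emeasure_eq_measure)
    fix \<pi> assume \<pi>: "\<pi> \<in> space R"
    have "(\<Sum>i\<in>I. \<Sum>D\<in>Pow I. \<Sum>z\<in>Pow I. indicator (ev i D z) \<pi>) \<le>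
      (\<Sum>i\<in>I. \<Sum>D\<in>Pow I. \<Sum>z\<in>Pow I. of_bool
        ((\<exists>j\<in>G1. good j (run \<pi> (ex (insert i (z \<inter> D))) (ey (insert i (z - D))))) \<longleftrightarrow> i \<in> G1) :: real)"
    proof (intro sum_mono)
      fix i D z assume "i \<in> I"
      define p where "p = run \<pi> (ex (insert i (z \<inter> D))) (ey (insert i (z - D)))"
      \<comment> \<open>The output becomes a bit by asking whether it is good for some element of
        \<open>G1\<close>; \<open>separated\<close> makes this bit right whenever the output is good
        for \<open>i\<close>.\<close>
      have "(\<exists>j\<in>G1. good j p) \<longleftrightarrow> i \<in> G1" if "good i p"
        using that separated[of _ i p] \<open>i \<in> I\<close> by (auto simp: I_def)
      then show "indicator (ev i D z) \<pi> \<le> (of_bool ((\<exists>j\<in>G1. good j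
          (run \<pi> (ex (insert i (z \<inter> D))) (ey (insert i (z - D))))) \<longleftrightarrow> i \<in> G1) :: real)"
        using \<pi> by (simp add: ev_def indicator_def p_def)
    qed
    also have "\<dots> \<le> bound"
      unfolding bound_def I_def using bits[OF \<pi>] by (intro deterministic_successes_le fin disj card)
    finally show "(\<Sum>i\<in>I. \<Sum>D\<in>Pow I. \<Sum>z\<in>Pow I. indicator (ev i D z) \<pi>) \<le> bound" .
  qed simp
  also have "\<dots> = bound" by (simp add: prob_space)
  \<comment> \<open>The gap \<open>N / 6\<close> between the two multiples of \<open>N\<close> must
    be paid by communication, whence \<open>1800 = 6 * 300\<close>.\<close>
  finally have "4 / 3 * real N \<le> 7 / 6 * real N + 300 * (real b + 2)"
    by (simp add: bound_def)
  then show ?thesis by (simp add: field_simps)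
qed

subsection \<open>Rank and singular values\<close>

unbundle no vec_syntax

lemma index_mult_mat_sum:
  assumes "A \<in> carrier_mat n m" "B \<in> carrier_mat m p" "i < n" "j < p"
  shows "(A * B) $$ (i, j) = (\<Sum>l<m. A $$ (i, l) * B $$ (l, j))"
  using assms by (simp add: scalar_prod_def atLeast0LessThan)

text \<open>Padded with zero rows, the transposed array becomes a square matrix that is singular
  because its row \<open>q\<close> vanishes.\<close>

lemma exists_left_null_vector:
  fixes Z :: "nat \<Rightarrow> nat \<Rightarrow> 'a::field"
  assumes "q < p"
  shows "\<exists>c. (\<exists>i<p. c i \<noteq> 0) \<and> (\<forall>t<q. (\<Sum>i<p. c i * Z i t) = 0)"
proof -
  define A where "A = mat p p (\<lambda>(t, i). if t < q then Z i t else 0)"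
  have A: "A \<in> carrier_mat p p" by (simp add: A_def)
  have "transpose_mat A *\<^sub>v unit_vec p q = 0\<^sub>v p"
  proof (rule eq_vecI)
    fix i assume "i < dim_vec (0\<^sub>v p :: 'a vec)"
    then show "(transpose_mat A *\<^sub>v unit_vec p q) $ i = 0\<^sub>v p $ i"
      using assms A by (simp add: A_def scalar_prod_right_unit)
  qed (use A in simp)
  moreover have "unit_vec p q \<noteq> (0\<^sub>v p :: 'a vec)"
    using assms by (metis index_unit_vec(1) index_zero_vec(1) one_neq_zero)
  ultimately have "det (transpose_mat A) = 0"
    using A by (subst det_0_iff_vec_prod_zero_field[of _ p]) (auto intro!: exI[of _ "unit_vec p q"])
  then have "det A = 0" using det_transpose[OF A] by simp
  then obtain v where v: "v \<in> carrier_vec p" "v \<noteq> 0\<^sub>v p" "A *\<^sub>v v = 0\<^sub>v p"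
    using det_0_iff_vec_prod_zero_field[OF A] by blast
  have "(\<Sum>i<p. v $ i * Z i t) = 0" if "t < q" for t
  proof -
    have "(A *\<^sub>v v) $ t = (\<Sum>i<p. v $ i * Z i t)"
      using that assms v(1) by (simp add: A_def scalar_prod_def atLeast0LessThan mult.commute)
    then show ?thesis using that assms by (simp add: v(3))
  qed
  moreover have "\<exists>i<p. v $ i \<noteq> 0"
    using v(1,2) by (metis carrier_vecD eq_vecI index_zero_vec)
  ultimately show ?thesis by blast
qed

text \<open>\<open>X\<close> lists a maximal independent set of columns, and \<open>Y\<close> holds
  the coefficients of all columns in terms of it.\<close>

lemma rank_factorization:
  fixes A :: "'a::field mat"
  assumes A: "A \<in> carrier_mat d m" and rank: "vec_space.rank d A = k"
  shows "\<exists>X Y. \<forall>i<d. \<forall>j<m. A $$ (i, j) = (\<Sum>t<k. X i t * Y t j)"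
proof -
  interpret vec_space "TYPE('a)" d .
  let ?indep = "\<lambda>T. T \<subseteq> set (cols A) \<and> lin_indpt T"
  have "lin_indpt {}" by (simp add: finite_lin_indpt2)
  then obtain S where S: "finite S" "maximal S ?indep"
    using maximal_exists_superset[of "set (cols A)" ?indep "{}"] by auto
  then have sub: "S \<subseteq> set (cols A)" and indep: "lin_indpt S"
    and max: "\<And>T. S \<subseteq> T \<Longrightarrow> ?indep T \<Longrightarrow> T = S"
    by (auto simp: maximal_def)
  have cols: "set (cols A) \<subseteq> carrier_vec d" using cols_dim A by blast
  then have SV: "S \<subseteq> carrier_vec d" using sub by blast
  have card: "card S = k" using rank_card_indpt[OF A S(2)] rank by simp
  obtain us where us: "set us = S" "distinct us" using finite_distinct_list[OF S(1)] by blast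
  then have len: "length us = k" using card distinct_card by force
  have "\<exists>a. \<forall>i<d. A $$ (i, j) = (\<Sum>u\<in>S. a u * u $ i)" if "j < m" for j
  proof -
    have colj: "col A j \<in> set (cols A)" using that A by (simp add: cols_def)
    then have cV: "col A j \<in> carrier_vec d" using cols by blast
    have "col A j \<in> span S"
    proof (rule ccontr)
      assume notin: "col A j \<notin> span S"
      then have "col A j \<notin> S" using SV span_mem by blast
      then have "lin_indpt (S \<union> {col A j})"
        using lin_dep_iff_in_span[of S "col A j"] SV indep cV notin by auto
      then have "S \<union> {col A j} = S" using max[of "S \<union> {col A j}"] sub colj by auto
      then show False using \<open>col A j \<notin> S\<close> by blast
    qed
    then obtain a where a: "col A j = lincomb a S"
      using finite_span[OF S(1)] SV by auto
    have "A $$ (i, j) = (\<Sum>u\<in>S. a u * u $ i)" if "i < d" for i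
    proof -
      have "A $$ (i, j) = col A j $ i" using that \<open>j < m\<close> A by simp
      then show ?thesis using lincomb_index[OF that SV, of a] a by simp
    qed
    then show ?thesis by blast
  qed
  then obtain a where a: "\<And>i j. i < d \<Longrightarrow> j < m \<Longrightarrow> A $$ (i, j) = (\<Sum>u\<in>S. a j u * u $ i)"
    by metis
  have "A $$ (i, j) = (\<Sum>t<k. us ! t $ i * a j (us ! t))" if "i < d" "j < m" for i j
  proof -
    have "(\<Sum>u\<in>S. a j u * u $ i) = (\<Sum>t<k. a j (us ! t) * us ! t $ i)"
      using bij_betw_nth[OF us(2) len[symmetric, THEN arg_cong[where f = lessThan]] us(1)[symmetric]]
      by (simp add: sum.reindex_bij_betw[symmetric])
    then show ?thesis using a[OF that] by (simp add: mult.commute)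
  qed
  then show ?thesis
    by (intro exI[of _ "\<lambda>i t. us ! t $ i"] exI[of _ "\<lambda>t j. a j (us ! t)"]) simp
qed

text \<open>With \<open>P = X Y\<close> through dimension \<open>k\<close>, the fixed rows satisfy
  \<open>E = E P = (E X) Y\<close>. The rows of \<open>E X\<close> have only \<open>k\<close>
  entries, and a dependence among them carries over to \<open>E\<close>.\<close>

lemma fixed_rows_dependent:
  fixes P :: "'a::field mat"
  assumes P: "P \<in> carrier_mat d d" "vec_space.rank d P = k" and "k < p"
    and fixed: "\<And>i j. i < p \<Longrightarrow> j < d \<Longrightarrow> (\<Sum>l<d. E i l * P $$ (l, j)) = E i j"
  shows "\<exists>c. (\<exists>i<p. c i \<noteq> 0) \<and> (\<forall>j<d. (\<Sum>i<p. c i * E i j) = 0)"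
proof -
  obtain X Y where XY: "\<And>i j. i < d \<Longrightarrow> j < d \<Longrightarrow> P $$ (i, j) = (\<Sum>t<k. X i t * Y t j)"
    using rank_factorization[OF P] by blast
  define Z where "Z i t = (\<Sum>l<d. E i l * X l t)" for i t
  have E: "E i j = (\<Sum>t<k. Z i t * Y t j)" if "i < p" "j < d" for i j
  proof -
    have "E i j = (\<Sum>l<d. E i l * P $$ (l, j))" using fixed[OF that] by simp
    also have "\<dots> = (\<Sum>l<d. E i l * (\<Sum>t<k. X l t * Y t j))"
      by (intro sum.cong refl) (simp add: XY that)
    also have "\<dots> = (\<Sum>l<d. \<Sum>t<k. E i l * X l t * Y t j)"
      by (simp add: sum_distrib_left mult.assoc)
    also have "\<dots> = (\<Sum>t<k. Z i t * Y t j)"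
      unfolding Z_def sum_distrib_right by (rule sum.swap)
    finally show ?thesis .
  qed
  obtain c where c: "\<exists>i<p. c i \<noteq> 0" "\<And>t. t < k \<Longrightarrow> (\<Sum>i<p. c i * Z i t) = 0"
    using exists_left_null_vector[OF \<open>k < p\<close>, of Z] by blast
  have "(\<Sum>i<p. c i * E i j) = 0" if "j < d" for j
  proof -
    have "(\<Sum>i<p. c i * E i j) = (\<Sum>i<p. \<Sum>t<k. c i * Z i t * Y t j)"
      by (intro sum.cong refl) (simp add: E that sum_distrib_left mult.assoc)
    also have "\<dots> = (\<Sum>t<k. (\<Sum>i<p. c i * Z i t) * Y t j)"
      unfolding sum_distrib_right by (rule sum.swap)
    finally show ?thesis using c(2) by simp
  qed
  with c(1) show ?thesis by blast
qed

text \<open>\<open>S = transpose_mat U * A * V\<close> factors through dimension \<open>k\<close>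
  like \<open>A\<close>, so its first \<open>k + 1\<close> rows are dependent and one of their
  diagonal entries is 0. As the singular values decrease, all from index \<open>k\<close> on vanish,
  and truncation changes nothing.\<close>

lemma svd_truncation_eq:
  assumes A: "A \<in> carrier_mat n d" and k: "k < min n d"
    and fac: "\<And>i j. i < n \<Longrightarrow> j < d \<Longrightarrow> A $$ (i, j) = (\<Sum>t<k. F i t * G t j)"
    and B: "svd_truncation k A B"
  shows "B = A"
proof -
  obtain U S V where svd: "is_svd A U S V" and B: "B = U * truncate_diag k S * transpose_mat V"
    using B by (auto simp: svd_truncation_def)
  have U: "U \<in> carrier_mat n n" and S: "S \<in> carrier_mat n d" and V: "V \<in> carrier_mat d d"
    and UU: "transpose_mat U * U = 1\<^sub>m n" and VV: "transpose_mat V * V = 1\<^sub>m d"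
    and diag: "diagonal_mat S"
    and pos: "\<And>i. i < min n d \<Longrightarrow> 0 \<le> S $$ (i, i)"
    and decr: "\<And>i j. i \<le> j \<Longrightarrow> j < min n d \<Longrightarrow> S $$ (j, j) \<le> S $$ (i, i)"
    and AUSV: "A = U * S * transpose_mat V"
    using svd A by (auto simp: is_svd_def Let_def)
  have offdiag: "S $$ (i, j) = 0" if "i < n" "j < d" "i \<noteq> j" for i j
    using diag that S by (auto simp: diagonal_mat_def)
  define Z where "Z i t = (\<Sum>a<n. U $$ (a, i) * F a t)" for i t
  define Y where "Y t j = (\<Sum>b<d. G t b * V $$ (b, j))" for t j
  have "transpose_mat U * A * V = transpose_mat U * (U * (S * (transpose_mat V * V)))"
    using U S V by (simp add: AUSV assoc_mult_mat[of _ n n _ d _ d] assoc_mult_mat[of _ n n _ n _ d]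
      assoc_mult_mat[of _ n d _ d _ d] mult_carrier_mat[of _ n d _ d])
  also have "\<dots> = (transpose_mat U * U) * S"
    using U S V by (simp add: VV assoc_mult_mat[of _ n n _ n _ d])
  finally have "S = transpose_mat U * A * V" using S by (simp add: UU)
  have SZY: "S $$ (i, j) = (\<Sum>t<k. Z i t * Y t j)" if "i < n" "j < d" for i j
  proof -
    have inner: "(transpose_mat U * A) $$ (i, b) = (\<Sum>t<k. Z i t * G t b)" if "b < d" for b
    proof -
      have "(transpose_mat U * A) $$ (i, b) = (\<Sum>a<n. U $$ (a, i) * (\<Sum>t<k. F a t * G t b))"
        using U \<open>i < n\<close> that
        by (subst index_mult_mat_sum[of _ n n _ d]) (auto simp: A fac intro!: sum.cong)
      also have "\<dots> = (\<Sum>a<n. \<Sum>t<k. U $$ (a, i) * F a t * G t b)"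
        by (simp add: sum_distrib_left mult.assoc)
      also have "\<dots> = (\<Sum>t<k. Z i t * G t b)"
        unfolding Z_def sum_distrib_right by (rule sum.swap)
      finally show ?thesis .
    qed
    have "S $$ (i, j) = (\<Sum>b<d. (transpose_mat U * A) $$ (i, b) * V $$ (b, j))"
      unfolding \<open>S = transpose_mat U * A * V\<close>
      by (rule index_mult_mat_sum[OF mult_carrier_mat[OF _ A] V that]) (use U in simp)
    also have "\<dots> = (\<Sum>b<d. (\<Sum>t<k. Z i t * G t b) * V $$ (b, j))"
      by (simp add: inner)
    also have "\<dots> = (\<Sum>b<d. \<Sum>t<k. Z i t * (G t b * V $$ (b, j)))"
      by (simp add: sum_distrib_right mult.assoc)
    also have "\<dots> = (\<Sum>t<k. Z i t * Y t j)"
      unfolding Y_def sum_distrib_left by (rule sum.swap)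
    finally show ?thesis .
  qed
  obtain c where c: "\<exists>i<Suc k. c i \<noteq> 0" "\<And>t. t < k \<Longrightarrow> (\<Sum>i<Suc k. c i * Z i t) = 0"
    using exists_left_null_vector[of k "Suc k" Z] by blast
  then obtain l where l: "l \<le> k" "c l \<noteq> 0" by (auto simp: less_Suc_eq_le)
  \<comment> \<open>Off-diagonal entries vanish, so column \<open>l\<close> isolates
    \<open>c l\<close>; \<open>k < min n d\<close> gives each of the \<open>k + 1\<close> rows a
    diagonal entry.\<close>
  have "c l * S $$ (l, l) = (\<Sum>i<Suc k. c i * S $$ (i, l))"
  proof -
    have "(\<Sum>i<Suc k. c i * S $$ (i, l)) = (\<Sum>i\<in>{l}. c i * S $$ (i, l))"
      using l k offdiag by (intro sum.mono_neutral_right) auto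
    then show ?thesis by simp
  qed
  also have "\<dots> = (\<Sum>i<Suc k. \<Sum>t<k. c i * Z i t * Y t l)"
    using k l by (intro sum.cong refl) (simp add: SZY sum_distrib_left mult.assoc)
  also have "\<dots> = (\<Sum>t<k. (\<Sum>i<Suc k. c i * Z i t) * Y t l)"
    unfolding sum_distrib_right by (rule sum.swap)
  also have "\<dots> = 0" using c(2) by simp
  finally have "S $$ (l, l) = 0" using l by simp
  then have zero: "S $$ (i, i) = 0" if "k \<le> i" "i < min n d" for i
    using decr[of l i] pos[of i] that l by simp
  have "truncate_diag k S = S"
  proof (rule eq_matI)
    fix i j assume "i < dim_row S" "j < dim_col S"
    then show "truncate_diag k S $$ (i, j) = S $$ (i, j)"
      using S offdiag[of i j] zero[of i] by (cases "i = j") (auto simp: truncate_diag_def)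
  qed (simp_all add: truncate_diag_def)
  then show ?thesis using B AUSV by simp
qed

text \<open>By \<open>svd_truncation_eq\<close> the best error is 0, so the relative guarantee
  forces \<open>A * P = A\<close>.\<close>

lemma good_projection_fixes:
  assumes good: "good_projection k \<epsilon> A P"
    and A: "A \<in> carrier_mat n d" and k: "k < min n d"
    and fac: "\<And>i j. i < n \<Longrightarrow> j < d \<Longrightarrow> A $$ (i, j) = (\<Sum>t<k. F i t * G t j)"
    and ij: "i < n" "j < d"
  shows "(\<Sum>l<d. A $$ (i, l) * P $$ (l, j)) = A $$ (i, j)"
proof -
  obtain B where P: "P \<in> carrier_mat d d" and B: "svd_truncation k A B"
    and le: "(frob_norm (A - A * P))\<^sup>2 \<le> (1 + \<epsilon>) * (frob_norm (A - B))\<^sup>2"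
    using good A by (auto simp: good_projection_def rank_projection_def)
  have "B = A" using svd_truncation_eq[OF A k fac B] by simp
  then have "frob_norm (A - B) = 0" using A by (simp add: frob_norm_def)
  with le have "(frob_norm (A - A * P))\<^sup>2 \<le> 0" by simp
  then have "frob_norm (A - A * P) = 0" by simp
  then have "(\<Sum>i<n. \<Sum>j<d. ((A - A * P) $$ (i, j))\<^sup>2) = 0"
    using A P by (simp add: frob_norm_def)
  then have "((A - A * P) $$ (i, j))\<^sup>2 = 0"
    using ij by (simp add: sum_nonneg_eq_0_iff sum_nonneg)
  then have "(A * P) $$ (i, j) = A $$ (i, j)" using A P ij by simp
  then show ?thesis using index_mult_mat_sum[OF A P ij] by simp
qed

subsection \<open>Matrices with a hidden zero\<close>

text \<open>For \<open>1 < k < d\<close> the rows span a space of dimension \<open>k - 1\<close>, however close \<open>k\<close> is to \<open>d\<close>,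
  that meets the span of \<open>e\<^sub>a\<close> and \<open>e\<^sub>b\<close> only in \<open>0\<close> when \<open>a\<close> is odd and \<open>b > 0\<close> is even. Only
  the rows below the \<open>k\<close>-th carry hidden zeros.\<close>

definition base_entry :: "nat \<Rightarrow> nat \<Rightarrow> nat \<Rightarrow> bool" where
  "base_entry k r c \<longleftrightarrow> (3 \<le> r \<and> r \<le> k \<longrightarrow> c = r \<or> c = (if odd r then 1 else 2))"

definition hard_mat :: "real \<Rightarrow> nat \<Rightarrow> nat \<Rightarrow> nat \<Rightarrow> (nat \<times> nat) set \<Rightarrow> real mat" where
  "hard_mat s n d k x =
     mat n d (\<lambda>(r, c). if base_entry k r c \<and> (r, c) \<notin> x then s else 0)"

lemma hard_mat_in_inputs: "{0, s} \<subseteq> X \<Longrightarrow> hard_mat s n d k x \<in> inputs X n d"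
  by (auto simp: inputs_def hard_mat_def elements_mat_def)

lemma entrywise_hard_mat:
  assumes "g s s = s" "g s 0 = s" "g 0 s = s" "g 0 0 = 0"
  shows "entrywise g (hard_mat s n d k x) (hard_mat s n d k y) = hard_mat s n d k (x \<inter> y)"
  by (rule eq_matI) (auto simp: entrywise_def hard_mat_def assms)

text \<open>The \<open>k\<close> row vectors are the all-ones row (\<open>t = 0\<close>), the unit
  vector of column \<open>j\<close> (\<open>t = 1\<close>) and the base rows 3 to \<open>k\<close>,
  row \<open>i\<close> at \<open>t = i - 1\<close>. Row \<open>r\<close> is all-ones minus the unit
  vector.\<close>

lemma hard_mat_factorization:
  assumes k: "1 < k" "k < r" and "i < n" "c < d"
  shows "hard_mat s n d k {(r, j)} $$ (i, c) =
    (\<Sum>t<k. (if 3 \<le> i \<and> i \<le> k then (if t = i - 1 then s else 0)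
             else if t = 0 then s else if t = 1 \<and> i = r then - s else 0)
      * (if t = 0 then 1 else if t = 1 then of_bool (c = j) else of_bool (base_entry k (t + 1) c)))"
proof (cases "3 \<le> i \<and> i \<le> k")
  case True
  then have "i - 1 < k" "i - 1 \<noteq> 0" "i - 1 \<noteq> 1" "i - 1 + 1 = i" "i \<noteq> r" using k by auto
  then show ?thesis
    using True assms by (simp add: hard_mat_def if_distrib[where f = "\<lambda>x. x * _"] cong: if_cong)
next
  case False
  have "(\<Sum>t<k. (if t = 0 then s else if t = 1 \<and> i = r then - s else 0)
      * (if t = 0 then 1 else if t = 1 then of_bool (c = j) else of_bool (base_entry k (t + 1) c)))
    = (\<Sum>t\<in>{0, 1}. (if t = 0 then s else if t = 1 \<and> i = r then - s else 0)
      * (if t = 0 then 1 else if t = 1 then of_bool (c = j) else of_bool (base_entry k (t + 1) c)))"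
    using k by (intro sum.mono_neutral_right) auto
  also have "\<dots> = hard_mat s n d k {(r, j)} $$ (i, c)"
    using False assms by (auto simp: hard_mat_def base_entry_def)
  finally show ?thesis by (simp only: False if_False)
qed

text \<open>The base rows 3 to \<open>k\<close> are the edges of two stars, odd leaves joined to
  centre 1 and even leaves to centre 2. Parity puts \<open>a\<close> and \<open>b\<close> into
  different stars; within one star the difference of two edges would be a difference of unit
  vectors. Column 0 meets only the all-ones row.\<close>

lemma star_rows_independent:
  fixes c :: "nat \<Rightarrow> real"
  assumes k: "1 < k" "k < d" and a: "odd a" "a < d" and b: "even b" "0 < b" "b < d"
    and zero: "\<And>l. l < d \<Longrightarrow> (\<Sum>i<Suc k. c i * (if i = 0 then 1 else if i = 1 then of_bool (l = a)
      else if i = 2 then of_bool (l = b) else of_bool (base_entry k i l))) = 0"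
    and i: "i < Suc k"
  shows "c i = 0"
proof -
  have split: "{..<Suc k} = {0, 1, 2} \<union> {3..k}" using k by auto
  have col: "c 0 + c 1 * of_bool (l = a) + c 2 * of_bool (l = b)
      + (\<Sum>i\<in>{3..k}. c i * of_bool (l = i \<or> l = (if odd i then 1 else 2))) = 0" if "l < d" for l
  proof -
    have "(\<Sum>i\<in>{3..k}. c i * (if i = 0 then 1 else if i = 1 then of_bool (l = a)
        else if i = 2 then of_bool (l = b) else of_bool (base_entry k i l)))
      = (\<Sum>i\<in>{3..k}. c i * of_bool (l = i \<or> l = (if odd i then 1 else 2)))"
      by (intro sum.cong refl) (auto simp: base_entry_def)
    moreover have "(\<Sum>i\<in>{0, 1, 2} \<union> {3..k}. c i * (if i = 0 then 1 else if i = 1 then of_bool (l = a)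
        else if i = 2 then of_bool (l = b) else of_bool (base_entry k i l)))
      = c 0 + c 1 * of_bool (l = a) + c 2 * of_bool (l = b)
        + (\<Sum>i\<in>{3..k}. c i * (if i = 0 then 1 else if i = 1 then of_bool (l = a)
        else if i = 2 then of_bool (l = b) else of_bool (base_entry k i l)))"
      by (subst sum.union_disjoint) auto
    ultimately show ?thesis using zero[OF that, unfolded split] by simp
  qed
  have c0: "c 0 = 0"
  proof -
    have "(\<Sum>i\<in>{3..k}. c i * of_bool (0 = i \<or> 0 = (if odd i then 1 else (2::nat)))) = 0"
      by (intro sum.neutral) auto
    then show ?thesis using col[of 0] k a b by (auto elim: oddE)
  qed
  have leaf: "c 1 * of_bool (l = a) + c 2 * of_bool (l = b) + (if l \<le> k then c l else 0) = 0"
    if "3 \<le> l" "l < d" for l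
  proof -
    have "(\<Sum>i\<in>{3..k}. c i * of_bool (l = i \<or> l = (if odd i then 1 else 2)))
        = (\<Sum>i\<in>{3..k}. if i = l then c i else 0)"
      using that by (intro sum.cong refl) auto
    also have "\<dots> = (if l \<le> k then c l else 0)" using that by simp
    finally show ?thesis using col[of l] c0 that by simp
  qed
  have odd_leaf: "c 1 * of_bool (l = a) + c l = 0" if "l \<in> {3..k}" "odd l" for l
    using leaf[of l] that k b(1) by (cases "l = b") auto
  have even_leaf: "c 2 * of_bool (l = b) + c l = 0" if "l \<in> {3..k}" "even l" for l
    using leaf[of l] that k a(1) by (cases "l = a") auto
  \<comment> \<open>In the star of centre 1 only the edge at \<open>a\<close> can have a nonzero
    coefficient, namely \<open>- c 1\<close>, so column 1 forces \<open>c 1 = 0\<close> if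
    \<open>a\<close> is the centre or a leaf. For \<open>a > k\<close> no edge meets column
    \<open>a\<close>, and \<open>leaf\<close> gives it directly.\<close>
  have c1: "c 1 = 0"
  proof -
    have "(\<Sum>i\<in>{3..k}. c i * of_bool (1 = i \<or> 1 = (if odd i then 1 else (2::nat))))
        = (\<Sum>i\<in>{3..k}. if i = a then - c 1 else 0)"
    proof (intro sum.cong refl)
      fix i assume "i \<in> {3..k}"
      then show "c i * of_bool (1 = i \<or> 1 = (if odd i then 1 else (2::nat))) = (if i = a then - c 1 else 0)"
        using odd_leaf[of i] a(1) by (cases "odd i"; cases "i = a") (auto simp: add_eq_0_iff)
    qed
    also have "\<dots> = (if a \<in> {3..k} then - c 1 else 0)" by simp
    finally have centre: "c 1 * of_bool (1 = a) + (if a \<in> {3..k} then - c 1 else 0) = 0"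
      using col[of 1] c0 k b(1) by (cases "b = 1") auto
    have "a = 1 \<or> 3 \<le> a" using a(1) by presburger
    then consider "a = 1" | "a \<in> {3..k}" | "a \<noteq> 1" "3 \<le> a" "k < a" by fastforce
    then show ?thesis
    proof cases
      case 3
      then show ?thesis using leaf[of a] a b(1) by (cases "a = b") auto
    qed (use centre in auto)
  qed
  have c2: "c 2 = 0"
  proof -
    have "(\<Sum>i\<in>{3..k}. c i * of_bool (2 = i \<or> 2 = (if odd i then 1 else (2::nat))))
        = (\<Sum>i\<in>{3..k}. if i = b then - c 2 else 0)"
    proof (intro sum.cong refl)
      fix i assume "i \<in> {3..k}"
      then show "c i * of_bool (2 = i \<or> 2 = (if odd i then 1 else (2::nat))) = (if i = b then - c 2 else 0)"
        using even_leaf[of i] b(1) by (cases "odd i"; cases "i = b") (auto simp: add_eq_0_iff)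
    qed
    also have "\<dots> = (if b \<in> {3..k} then - c 2 else 0)" by simp
    finally have centre: "c 2 * of_bool (2 = b) + (if b \<in> {3..k} then - c 2 else 0) = 0"
      using col[of 2] c0 k a(1) by (cases "a = 2") auto
    have "b = 2 \<or> 3 \<le> b" using b(1,2) by presburger
    then consider "b = 2" | "b \<in> {3..k}" | "b \<noteq> 2" "3 \<le> b" "k < b" by fastforce
    then show ?thesis
    proof cases
      case 3
      then show ?thesis using leaf[of b] b a(1) by (cases "a = b") auto
    qed (use centre in auto)
  qed
  show ?thesis
  proof (cases "3 \<le> i")
    case True
    then show ?thesis using leaf[of i] i k c1 c2 by simp
  next
    case False
    then have "i = 0 \<or> i = 1 \<or> i = 2" by auto
    then show ?thesis using c0 c1 c2 by auto
  qed
qed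

text \<open>A common \<open>P\<close> would fix the \<open>k + 1\<close> rows of
  \<open>star_rows_independent\<close>, too many for rank \<open>k\<close>.\<close>

lemma good_projections_separated:
  assumes k: "1 < k" "k < d" and s: "s \<noteq> 0"
    and r: "k < r" "r < n" "k < r'" "r' < n" and a: "odd a" "a < d" and b: "even b" "0 < b" "b < d"
    and ga: "good_projection k \<epsilon> (hard_mat s n d k {(r, a)}) P"
    and gb: "good_projection k \<epsilon> (hard_mat s n d k {(r', b)}) P"
  shows False
proof -
  have fix_row: "(\<Sum>l<d. of_bool (base_entry k i l \<and> (i, l) \<noteq> (q, j)) * P $$ (l, c))
      = of_bool (base_entry k i c \<and> (i, c) \<noteq> (q, j))"
    if good: "good_projection k \<epsilon> (hard_mat s n d k {(q, j)}) P"
      and "k < q" "q < n" "i < n" "c < d" for q j i c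
  proof -
    have "(\<Sum>l<d. hard_mat s n d k {(q, j)} $$ (i, l) * P $$ (l, c)) = hard_mat s n d k {(q, j)} $$ (i, c)"
    proof (rule good_projection_fixes[OF good])
      show "hard_mat s n d k {(q, j)} \<in> carrier_mat n d" by (simp add: hard_mat_def)
      show "k < min n d" using that k by simp
    qed (use that k in \<open>simp_all only: hard_mat_factorization\<close>)
    also have "\<dots> = s * of_bool (base_entry k i c \<and> (i, c) \<noteq> (q, j))"
      using that by (simp add: hard_mat_def)
    also have "(\<Sum>l<d. hard_mat s n d k {(q, j)} $$ (i, l) * P $$ (l, c))
        = s * (\<Sum>l<d. of_bool (base_entry k i l \<and> (i, l) \<noteq> (q, j)) * P $$ (l, c))"
      unfolding sum_distrib_left using that by (intro sum.cong refl) (simp add: hard_mat_def)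
    finally show ?thesis using s by simp
  qed
  have ones: "(\<Sum>l<d. P $$ (l, c)) = 1" if "c < d" for c
    using fix_row[OF ga, of 0 c] r that by (simp add: base_entry_def)
  have unit: "(\<Sum>l<d. of_bool (l = j) * P $$ (l, c)) = of_bool (c = j)"
    if good: "good_projection k \<epsilon> (hard_mat s n d k {(q, j)}) P" and "k < q" "q < n" "c < d" for q j c
  proof -
    \<comment> \<open>The unit vector of column \<open>j\<close> is the all-ones row minus row
      \<open>q\<close>, and \<open>P\<close> fixes both.\<close>
    have "(\<Sum>l<d. of_bool (l = j) * P $$ (l, c))
        = (\<Sum>l<d. P $$ (l, c)) - (\<Sum>l<d. of_bool (base_entry k q l \<and> (q, l) \<noteq> (q, j)) * P $$ (l, c))"
      unfolding sum_subtractf[symmetric] using \<open>k < q\<close>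
      by (intro sum.cong refl) (auto simp: base_entry_def)
    also have "\<dots> = of_bool (c = j)"
      using fix_row[OF good that(2,3,3,4)] ones[OF that(4)] \<open>k < q\<close> by (auto simp: base_entry_def)
    finally show ?thesis .
  qed
  define E where "E i l = (if i = 0 then 1 else if i = 1 then of_bool (l = a)
      else if i = 2 then of_bool (l = b) else of_bool (base_entry k i l) :: real)" for i l :: nat
  have P: "P \<in> carrier_mat d d" "vec_space.rank d P = k"
    using ga by (auto simp: good_projection_def rank_projection_def hard_mat_def)
  have "\<exists>c. (\<exists>i<Suc k. c i \<noteq> 0) \<and> (\<forall>j<d. (\<Sum>i<Suc k. c i * E i j) = 0)"
  proof (rule fixed_rows_dependent[OF P])
    fix i c assume "i < Suc k" "c < d"
    then show "(\<Sum>l<d. E i l * P $$ (l, c)) = E i c"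
      using ones[of c] unit[OF ga r(1,2)] unit[OF gb r(3,4)] fix_row[OF ga r(1,2), of i c] r
      by (auto simp: E_def)
  qed simp
  then obtain c i where "i < Suc k" "c i \<noteq> 0" and dep: "\<And>l. l < d \<Longrightarrow> (\<Sum>i<Suc k. c i * E i l) = 0"
    by blast
  have "c i = 0"
    by (rule star_rows_independent[OF k a b _ \<open>i < Suc k\<close>]) (use dep in \<open>simp add: E_def\<close>)
  with \<open>c i \<noteq> 0\<close> show False by blast
qed

section \<open>Choice of the cells and the final constants\<close>

lemma computes_projection_bits_ge:
  assumes g: "g s s = s" "g s 0 = s" "g 0 s = s" "g 0 0 = 0" and s: "s \<noteq> 0" "{0, s} \<subseteq> X"
    and k: "1 < k" "k < d" and n: "6400 * d \<le> n"
    and comp: "computes_projection g X n d k \<epsilon> b R"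
  shows "real (n * d) \<le> 28800 * real b"
proof -
  \<comment> \<open>Columns \<open>2 * a + 1\<close> and \<open>2 * a + 2\<close> with
    \<open>a < q\<close> stay below \<open>d\<close>. Column 0 hides no zero, as
    \<open>star_rows_independent\<close> asks for \<open>0 < b\<close>.\<close>
  define q where "q = (d - 1) div 2"
  define G where "G e = {k<..<n} \<times> (\<lambda>a. 2 * a + e) ` {..<q}" for e :: nat
  have "card ((\<lambda>a :: nat. 2 * a + e) ` {..<q}) = q" for e
    by (subst card_image) (auto simp: inj_on_def)
  then have card: "card (G e) = (n - k - 1) * q" for e
    by (simp add: G_def card_cartesian_product)
  have fin: "finite (G e)" for e by (simp add: G_def)
  have prob: "prob_space R" using comp by (simp add: computes_projection_def)
  have "real ((n - k - 1) * q) \<le> 1800 * (real b + 2)"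
  proof (rule communication_lower_bound[OF prob fin fin _ card card, of 1 2 "hard_mat s n d k" "hard_mat s n d k"
        b "\<lambda>i P. good_projection k \<epsilon> (hard_mat s n d k {i}) P"])
    show "G 1 \<inter> G 2 = {}"
    proof -
      have "2 * a + 1 \<noteq> 2 * a' + (2::nat)" for a a' by presburger
      then show ?thesis by (auto simp: G_def)
    qed
    show "bits \<pi> (hard_mat s n d k x) (hard_mat s n d k y) \<le> b" if "\<pi> \<in> space R" for \<pi> x y
      using comp hard_mat_in_inputs[OF s(2)] that by (simp add: computes_projection_def)
    show "2 / 3 \<le> measure R {\<pi> \<in> space R. good_projection k \<epsilon> (hard_mat s n d k {i})
        (run \<pi> (hard_mat s n d k x) (hard_mat s n d k y))}" if "x \<inter> y = {i}" for i x y
    proof -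
      have "2 / 3 \<le> measure R {\<pi> \<in> space R. good_projection k \<epsilon>
          (entrywise g (hard_mat s n d k x) (hard_mat s n d k y))
          (run \<pi> (hard_mat s n d k x) (hard_mat s n d k y))}"
        using comp hard_mat_in_inputs[OF s(2)] by (simp add: computes_projection_def)
      then show ?thesis by (simp add: entrywise_hard_mat g that)
    qed
    fix i j P
    assume i: "i \<in> G 1" and j: "j \<in> G 2" and good: "good_projection k \<epsilon> (hard_mat s n d k {i}) P"
    obtain r a where i_eq: "i = (r, 2 * a + 1)" and ra: "k < r" "r < n" "a < q" using i by (auto simp: G_def)
    obtain r' a' where j_eq: "j = (r', 2 * a' + 2)" and ra': "k < r'" "r' < n" "a' < q" using j by (auto simp: G_def)
    have "2 * a + 1 < d" "2 * a' + 2 < d" using ra(3) ra'(3) by (auto simp: q_def)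
    then show "\<not> good_projection k \<epsilon> (hard_mat s n d k {j}) P"
      using good_projections_separated[OF k s(1) ra(1,2) ra'(1,2), of "2 * a + 1" "2 * a' + 2" \<epsilon> P] good
      by (auto simp: i_eq j_eq)
  qed
  \<comment> \<open>\<open>k < d \<le> n / 6400\<close> leaves at least half of the rows, and
    \<open>d \<le> 4 * q\<close> holds from \<open>d = 3\<close> on, with equality at
    \<open>d = 4\<close>.\<close>
  moreover have "n * d \<le> 8 * ((n - k - 1) * q)"
  proof -
    have "3 \<le> d" using k by simp
    then have "d \<le> 4 * q" unfolding q_def by presburger
    moreover have "n \<le> 2 * (n - k - 1)" using k n by auto
    ultimately have "n * d \<le> (2 * (n - k - 1)) * (4 * q)" by (intro mult_mono) auto
    then show ?thesis by (simp add: mult_ac)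
  qed
  then have "real (n * d) \<le> 8 * real ((n - k - 1) * q)"
    by (metis of_nat_le_iff of_nat_mult of_nat_numeral)
  \<comment> \<open>\<open>57600 = 6400 * 3 * 3\<close>. In
    \<open>n * d \<le> 14400 * (b + 2)\<close> the constant part 28800 is then at most half of
    \<open>n * d\<close>, which doubles the factor of \<open>b\<close>.\<close>
  moreover have "57600 \<le> real (n * d)"
  proof -
    have "(6400 * 3) * 3 \<le> n * d" using k n by (intro mult_mono) auto
    then have "real 57600 \<le> real (n * d)" by (simp only: of_nat_le_iff)
    then show ?thesis by simp
  qed
  moreover have "x \<le> 28800 * y" if "N \<le> 1800 * (y + 2)" "x \<le> 8 * N" "57600 \<le> x" for x y N :: real
    using that by (simp add: algebra_simps)
  ultimately show ?thesis by blast
qed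

theorem theorem6:
  shows "\<exists>c::real. c > 0 \<and> (\<exists>p C::nat. \<forall>(n::nat) (d::nat) (k::nat) (\<epsilon>::real) (X::real set) (b::nat) R.
           1 < k \<longrightarrow> k < d \<longrightarrow> C * d \<le> n \<longrightarrow> 0 < \<epsilon> \<longrightarrow>
           ({0, 1} \<subseteq> X \<longrightarrow> computes_projection max X n d k \<epsilon> b R \<longrightarrow>
              c * real (n * d) / ln (real (n * d)) ^ p \<le> real b) \<and>
           (\<forall>\<kappa>::real. 0 < \<kappa> \<longrightarrow> {0, \<kappa>} \<subseteq> X \<longrightarrow>
              computes_projection (\<lambda>x y. huber \<kappa> (x + y)) X n d k \<epsilon> b R \<longrightarrow>
              c * real (n * d) / ln (real (n * d)) ^ p \<le> real b))"
proof (rule exI[of _ "1 / 28800"], rule conjI, simp, rule exI[of _ 0], rule exI[of _ 6400],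
    intro allI impI conjI)
  fix n d k :: nat and \<epsilon> :: real and X :: "real set" and b R
  assume k: "1 < k" "k < d" and n: "6400 * d \<le> n"
  show "1 / 28800 * real (n * d) / ln (real (n * d)) ^ 0 \<le> real b"
    if "{0, 1} \<subseteq> X" "computes_projection max X n d k \<epsilon> b R"
    using computes_projection_bits_ge[OF _ _ _ _ _ that(1) k n that(2)] by simp
  \<comment> \<open>Here \<open>s = \<kappa>\<close>: the threshold cuts
    \<open>\<kappa> + \<kappa>\<close> back to \<open>\<kappa>\<close>, so the capped sum acts as an
    OR.\<close>
  show "1 / 28800 * real (n * d) / ln (real (n * d)) ^ 0 \<le> real b"
    if "0 < \<kappa>" "{0, \<kappa>} \<subseteq> X" "computes_projection (\<lambda>x y. huber \<kappa> (x + y)) X n d k \<epsilon> b R" for \<kappa>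
    using computes_projection_bits_ge[OF _ _ _ _ _ that(2) k n that(3)] that(1) by (simp add: huber_def)
qed

end
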